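(* Let $N = N(\iota)$ be an increasing sequence of positive integers and, for each $\iota$, let $\bm A, \bm B \in \mathbb{C}^{N\times N}$ be random orthogonal projection matrices. Suppose that for some $\alpha,\beta\in(0,1)$, $$\lim_{\iota\to\infty}\Big(\tfrac1N\mathbb{E}\operatorname{Tr}(\bm A)-\alpha\Big)=0,\qquad \lim_{\iota\to\infty}\Big(\tfrac1N\mathbb{E}\operatorname{Tr}(\bm B)-\beta\Big)=0,$$ and, for every integer $k\ge 1$, $$\lim_{\iota\to\infty}\frac1N\mathbb{E}\operatorname{Tr}\Big(\big((\bm A-\alpha\bm I_N)(\bm B-\beta\bm I_N)\big)^k\Big)=0.$$ Then the empirical spectral distribution of $\bm A\bm B\bm A$ converges in moments to $\mathsf{MANOVA}(\alpha,\beta)$.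
   Context: For $\alpha,\beta\in(0,1)$, $\mathsf{MANOVA}(\alpha,\beta)$ is the probability measure on $\mathbb{R}$ $$d\mu(x)=\frac{\sqrt{(r_+-x)(x-r_-)}}{2\pi x(1-x)}\mathbf 1_{[r_-,r_+]}(x)\,dx+(1-\min\{\alpha,\beta\})\delta_0+\max\{\alpha+\beta-1,0\}\delta_1,$$ where $r_\pm=r_\pm(\alpha,\beta)=\big(\sqrt{\alpha(1-\beta)}\pm\sqrt{\beta(1-\alpha)}\big)^2$ and $\delta_c$ is the Dirac mass at $c$. The empirical spectral distribution (e.s.d.) of a Hermitian $N\times N$ matrix with eigenvalues $\lambda_1,\dots,\lambda_N$ is $\frac1N\sum_i\delta_{\lambda_i}$. Random probability measures $\mu_\iota$ converge in moments to a deterministic $\mu$ if for every $k\ge1$, $\lim_\iota\mathbb{E}\int x^k d\mu_\iota(x)=\int x^k d\mu(x)$ (finite). Powers bind before the trace. *)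

theory Defs
  imports "HOL-Probability.Probability" "Jordan_Normal_Form.Schur_Decomposition"
    "Jordan_Normal_Form.Char_Poly"
begin

definition mat_tr :: "complex mat \<Rightarrow> complex" where
  "mat_tr X = (\<Sum>i < dim_row X. X $$ (i, i))"

definition orth_proj_mat :: "nat \<Rightarrow> complex mat \<Rightarrow> bool" where
  "orth_proj_mat n P \<longleftrightarrow> P \<in> carrier_mat n n \<and> P * P = P \<and> mat_adjoint P = P"

text \<open>Empirical spectral distribution of a (Hermitian) square complex matrix: the
  measure on the reals putting mass (multiplicity / dimension) at each real eigenvalue
  (for Hermitian matrices all eigenvalues are real).\<close>
definition esd :: "complex mat \<Rightarrow> real measure" where
  "esd X = measure_of UNIV (sets borel)
     (\<lambda>S. ennreal (\<Sum>x \<in> {x::real. poly (char_poly X) (complex_of_real x) = 0} \<inter> S.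
              real (Polynomial.order (complex_of_real x) (char_poly X)) / real (dim_row X)))"

definition manova_rm :: "real \<Rightarrow> real \<Rightarrow> real" where
  "manova_rm \<alpha> \<beta> = (sqrt (\<alpha> * (1 - \<beta>)) - sqrt (\<beta> * (1 - \<alpha>)))\<^sup>2"

definition manova_rp :: "real \<Rightarrow> real \<Rightarrow> real" where
  "manova_rp \<alpha> \<beta> = (sqrt (\<alpha> * (1 - \<beta>)) + sqrt (\<beta> * (1 - \<alpha>)))\<^sup>2"

definition manova_density :: "real \<Rightarrow> real \<Rightarrow> real \<Rightarrow> real" where
  "manova_density \<alpha> \<beta> x =
     sqrt ((manova_rp \<alpha> \<beta> - x) * (x - manova_rm \<alpha> \<beta>)) / (2 * pi * x * (1 - x))
     * indicator {manova_rm \<alpha> \<beta> .. manova_rp \<alpha> \<beta>} x"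

definition MANOVA :: "real \<Rightarrow> real \<Rightarrow> real measure" where
  "MANOVA \<alpha> \<beta> = measure_of UNIV (sets borel)
     (\<lambda>S. emeasure (density lborel (\<lambda>x. ennreal (manova_density \<alpha> \<beta> x))) S
          + ennreal (1 - min \<alpha> \<beta>) * indicator S 0
          + ennreal (max (\<alpha> + \<beta> - 1) 0) * indicator S 1)"

definition converges_in_moments ::
    "(nat \<Rightarrow> 'a \<Rightarrow> real measure) \<Rightarrow> (nat \<Rightarrow> 'a measure) \<Rightarrow> real measure \<Rightarrow> bool" where
  "converges_in_moments \<mu> M \<nu> \<longleftrightarrow>
     (\<forall>k::nat. k \<ge> 1 \<longrightarrow> integrable \<nu> (\<lambda>x. x ^ k) \<and>
        ((\<lambda>\<iota>. \<integral>\<omega>. (\<integral>x. x ^ k \<partial>(\<mu> \<iota> \<omega>)) \<partial>(M \<iota>)) \<longlongrightarrow> (\<integral>x. x ^ k \<partial>\<nu>)) sequentially)"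

end

theory Submission
  imports Defs
begin

text \<open>
  Put \<open>C = (A - \<alpha>) (B - \<beta>)\<close>, \<open>Y = A B A\<close>, \<open>c = \<alpha> + \<beta> - 2 \<alpha> \<beta>\<close> and \<open>d = \<alpha> \<beta> (1 - \<alpha>) (1 - \<beta>)\<close>.
  On the range of \<open>A\<close> one has \<open>C\<^sup>2 = C Y - c C - d\<close>, so \<open>A C\<^sup>k A = Q\<^sub>k(Y)\<close> for polynomials \<open>Q\<^sub>k\<close> of degree \<open>k\<close>
  given by a three-term recurrence. Since \<open>(A - \<alpha>)\<^sup>2\<close> and \<open>(B - \<beta>)\<^sup>2\<close> are affine in \<open>A\<close> and \<open>B\<close>, the
  hypotheses force the normalised expected trace of \<open>A C\<^sup>k\<close> to vanish in the limit for \<open>k \<ge> 1\<close>; hence the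
  limiting moments of \<open>Y\<close> exist and are determined by \<open>Q\<^sub>k\<close> having integral \<open>0\<close> for \<open>k \<ge> 1\<close> and total
  mass \<open>\<alpha>\<close> on the range of \<open>A\<close>. The MANOVA law satisfies the same relations: its support has midpoint
  \<open>c\<close> and half-length \<open>2 sqrt d\<close>, the \<open>Q\<^sub>k\<close> are combinations of shifted Chebyshev polynomials, which are
  orthogonal for the semicircle weight, and \<open>1 / (x (1 - x)) = 1 / x + 1 / (1 - x)\<close>
  reduces everything to the integrals of the semicircle weight against \<open>1 / x\<close> and \<open>1 / (1 - x)\<close>.
\<close>

subsection \<open>Semicircle integrals\<close>

text \<open>An explicit antiderivative: the root itself plus multiples of the arcsines of two
  functions mapping \<open>{a..b}\<close> onto [-1, 1], one affine in \<open>x\<close> and one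
  affine in \<open>1 / x\<close>. It is differentiable only inside the interval, hence the interior
  form of the fundamental theorem. For \<open>a = 0\<close> the second arcsine would have constant
  argument 1, where arcsin has no derivative; its coefficient \<open>sqrt (a * b)\<close> is 0 then,
  so it is left out.\<close>

lemma has_integral_sqrt_quadratic_over_x:
  fixes a b :: real
  assumes "0 \<le> a" "a < b"
  shows "((\<lambda>x. sqrt ((b - x) * (x - a)) / x) has_integral pi * ((a + b) / 2 - sqrt (a * b))) {a..b}"
proof (cases "a = 0")
  case True
  define F where "F x = sqrt ((b - x) * x) + b / 2 * arcsin ((2 * x - b) / b)" for x
  have "((\<lambda>x. sqrt ((b - x) * x) / x) has_integral F b - F 0) {0..b}"
  proof (rule fundamental_theorem_of_calculus_interior)
    show "continuous_on {0..b} F"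
      unfolding F_def using assms by (intro continuous_intros) (auto simp: field_simps)
    show "(F has_vector_derivative sqrt ((b - x) * x) / x) (at x)" if x: "x \<in> {0<..<b}" for x
    proof -
      define S where "S = sqrt ((b - x) * x)"
      have S: "S > 0" "S\<^sup>2 = (b - x) * x" using x by (auto simp: S_def)
      have "1 - ((2 * x - b) / b)\<^sup>2 = (2 * S / b)\<^sup>2"
        using x by (simp add: power_divide power_mult_distrib S(2) field_simps) (simp add: power2_eq_square algebra_simps)
      then have r: "sqrt (1 - ((2 * x - b) / b)\<^sup>2) = 2 * S / b"
        using S x by (simp add: real_sqrt_unique)
      have lt: "-1 < (2 * x - b) / b" "(2 * x - b) / b < 1"
        using x by (auto simp: field_simps)
      have d1: "((\<lambda>x. sqrt ((b - x) * x)) has_real_derivative (b - 2 * x) * (inverse S / 2)) (at x)"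
        unfolding S_def using x by (auto intro!: derivative_eq_intros simp: field_simps)
      have d2: "((\<lambda>x. (2 * x - b) / b) has_real_derivative 2 / b) (at x)"
        using x by (auto intro!: derivative_eq_intros simp: field_simps)
      have "(F has_real_derivative ((b - 2 * x) * (inverse S / 2) + b / 2 * (inverse (2 * S / b) * (2 / b)))) (at x)"
        unfolding F_def r[symmetric] by (intro DERIV_add DERIV_cmult d1 DERIV_chain2[OF DERIV_arcsin[OF lt] d2])
      also have "(b - 2 * x) * (inverse S / 2) + b / 2 * (inverse (2 * S / b) * (2 / b)) = S\<^sup>2 / (x * S)"
        unfolding S(2) using S(1) x by (simp add: field_simps)
      also have "\<dots> = S / x" using S(1) by (simp add: power2_eq_square)
      finally show ?thesis
        unfolding S_def by (simp add: has_real_derivative_iff_has_vector_derivative)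
    qed
  qed (use assms in auto)
  moreover have "F b - F 0 = pi * (b / 2)"
    using assms by (simp add: F_def)
  ultimately show ?thesis using True by simp
next
  case False
  then have a: "a > 0" using assms by simp
  define p where "p = sqrt (a * b)"
  have p: "p > 0" "p\<^sup>2 = a * b" using a assms by (auto simp: p_def)
  \<comment> \<open>The affine function of \<open>1 / x\<close> with value -1 at \<open>a\<close>
    and 1 at \<open>b\<close>; its arcsine supplies the term \<open>p\<^sup>2 / (x * S)\<close> of
    the derivative.\<close>
  define g where "g x = ((a + b) - 2 * a * b / x) / (b - a)" for x
  define F where "F x = sqrt ((b - x) * (x - a)) + (a + b) / 2 * arcsin ((2 * x - a - b) / (b - a))
    - p * arcsin (g x)" for x
  have "((\<lambda>x. sqrt ((b - x) * (x - a)) / x) has_integral F b - F a) {a..b}"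
  proof (rule fundamental_theorem_of_calculus_interior)
    have "-1 \<le> g x \<and> g x \<le> 1" if "x \<in> {a..b}" for x
    proof -
      have "a * b \<le> b * x" "a * b \<le> a * b * b / x" "a * x \<le> a * b" using that a by (auto simp: field_simps)
      then show ?thesis using that a assms
        unfolding g_def by (auto simp: field_simps)
    qed
    then show "continuous_on {a..b} F"
      unfolding F_def using assms a unfolding g_def
      by (intro continuous_intros) (auto simp: field_simps)
    show "(F has_vector_derivative sqrt ((b - x) * (x - a)) / x) (at x)" if x: "x \<in> {a<..<b}" for x
    proof -
      define S where "S = sqrt ((b - x) * (x - a))"
      have S: "S > 0" "S\<^sup>2 = (b - x) * (x - a)" using x by (auto simp: S_def)
      have x0: "x > 0" and ba: "b - a > 0" using x a by auto
      have 1: "1 - ((2 * x - a - b) / (b - a))\<^sup>2 = (2 * S / (b - a))\<^sup>2"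
        using ba by (simp add: power_divide power_mult_distrib S(2) field_simps) (simp add: power2_eq_square algebra_simps)
      then have r1: "sqrt (1 - ((2 * x - a - b) / (b - a))\<^sup>2) = 2 * S / (b - a)"
        using S ba by (simp add: real_sqrt_unique)
      have 2: "1 - (g x)\<^sup>2 = (2 * p * S / (x * (b - a)))\<^sup>2"
        using ba x0 by (simp add: g_def power_divide power_mult_distrib S(2) p(2) field_simps) (simp add: power2_eq_square algebra_simps)
      then have r2: "sqrt (1 - (g x)\<^sup>2) = 2 * p * S / (x * (b - a))"
        using S ba x0 p by (simp add: real_sqrt_unique)
      have lt1: "-1 < (2 * x - a - b) / (b - a)" "(2 * x - a - b) / (b - a) < 1"
        using ba x by (auto simp: field_simps)
      have "(g x)\<^sup>2 < 1" using 2 S ba x0 p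
        by (smt (verit) divide_pos_pos mult_pos_pos zero_less_power)
      then have lt2: "-1 < g x" "g x < 1" by (auto simp: power2_less_1_iff abs_less_iff)
      have dg: "(g has_real_derivative 2 * p\<^sup>2 / (x\<^sup>2 * (b - a))) (at x)"
      proof -
        have "((\<lambda>x. (a + b) - 2 * a * b / x) has_real_derivative 2 * p\<^sup>2 / x\<^sup>2) (at x)"
          unfolding p(2) using x0 by (auto intro!: derivative_eq_intros simp: power2_eq_square)
        from DERIV_cdivide[OF this, of "b - a"] show ?thesis by (simp add: g_def[abs_def])
      qed
      have d1: "((\<lambda>x. sqrt ((b - x) * (x - a))) has_real_derivative (a + b - 2 * x) * (inverse S / 2)) (at x)"
      proof -
        have pos: "0 < (b - x) * (x - a)" using x by simp
        have "((\<lambda>x. (b - x) * (x - a)) has_real_derivative a + b - 2 * x) (at x)"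
          by (auto intro!: derivative_eq_intros)
        from DERIV_chain2[OF DERIV_real_sqrt[OF pos] this] show ?thesis
          by (simp add: S_def mult.commute)
      qed
      have d2: "((\<lambda>x. (2 * x - a - b) / (b - a)) has_real_derivative 2 / (b - a)) (at x)"
        by (intro DERIV_cdivide) (auto intro!: derivative_eq_intros)
      have "(F has_real_derivative ((a + b - 2 * x) * (inverse S / 2)
          + (a + b) / 2 * (inverse (2 * S / (b - a)) * (2 / (b - a)))
          - p * (inverse (2 * p * S / (x * (b - a))) * (2 * p\<^sup>2 / (x\<^sup>2 * (b - a)))))) (at x)"
        unfolding F_def r1[symmetric] r2[symmetric]
        by (intro DERIV_add DERIV_diff DERIV_cmult d1 DERIV_chain2[OF DERIV_arcsin[OF lt1] d2]
            DERIV_chain2[OF DERIV_arcsin[OF lt2] dg])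
      also have "(a + b - 2 * x) * (inverse S / 2)
          + (a + b) / 2 * (inverse (2 * S / (b - a)) * (2 / (b - a)))
          - p * (inverse (2 * p * S / (x * (b - a))) * (2 * p\<^sup>2 / (x\<^sup>2 * (b - a))))
          = (a + b - 2 * x) / (2 * S) + (a + b) / (2 * S) - p\<^sup>2 / (x * S)"
      proof -
        have "(a + b) / 2 * (inverse (2 * S / K) * (2 / K)) = (a + b) / (2 * S)"
          "p * (inverse (2 * p * S / (x * K)) * (2 * p\<^sup>2 / (x\<^sup>2 * K))) = p\<^sup>2 / (x * S)"
          if "K > 0" for K
          using S(1) x0 p(1) that by (simp_all add: field_simps power2_eq_square)
        from this[OF ba] show ?thesis by (simp only: inverse_eq_divide) simp
      qed
      also have "\<dots> = S\<^sup>2 / (x * S)"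
        unfolding S(2) p(2) using S(1) x0 by (simp add: field_simps)
      also have "\<dots> = S / x" using S(1) by (simp add: power2_eq_square)
      finally show ?thesis
        unfolding S_def by (simp add: has_real_derivative_iff_has_vector_derivative)
    qed
  qed (use assms in auto)
  moreover have "g b = 1" "g a = -1" "(2 * b - a - b) / (b - a) = 1" "(2 * a - a - b) / (b - a) = -1"
    using assms a by (auto simp: g_def field_simps)
  then have "F b - F a = pi * ((a + b) / 2 - p)"
    by (simp add: F_def arcsin_minus field_simps)
  ultimately show ?thesis by (simp add: p_def)
qed

text \<open>Substituting \<open>1 - x\<close> for \<open>x\<close> leads back to the weight
  \<open>1 / x\<close>, now on \<open>{1 - b..1 - a}\<close>, where \<open>b \<le> 1\<close> gives
  the nonnegative left end.\<close>

lemma has_integral_sqrt_quadratic_over_one_minus_x: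
  fixes a b :: real
  assumes "a < b" "b \<le> 1"
  shows "((\<lambda>x. sqrt ((b - x) * (x - a)) / (1 - x)) has_integral
    pi * (1 - (a + b) / 2 - sqrt ((1 - a) * (1 - b)))) {a..b}"
proof -
  have "((\<lambda>x. sqrt (((1 - a) - x) * (x - (1 - b))) / x) has_integral
    pi * (((1 - b) + (1 - a)) / 2 - sqrt ((1 - b) * (1 - a)))) {1 - b..1 - a}"
    using assms by (intro has_integral_sqrt_quadratic_over_x) auto
  from has_integral_affinity[OF this[unfolded cbox_interval[symmetric]], of "-1" 1]
  show ?thesis
    using assms by (simp add: algebra_simps image_diff_atLeastAtMost  add_divide_distrib diff_divide_distrib)
qed

text \<open>Chebyshev polynomials of the second kind, shifted to the interval with midpoint \<open>c\<close> and half-length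
  \<open>2 sqrt d\<close>, with \<open>cheb_U c d (k + 1)\<close> monic of degree \<open>k\<close>.\<close>

fun cheb_U :: "real \<Rightarrow> real \<Rightarrow> nat \<Rightarrow> real \<Rightarrow> real" where
  "cheb_U c d 0 x = 0"
| "cheb_U c d (Suc 0) x = 1"
| "cheb_U c d (Suc (Suc k)) x = (x - c) * cheb_U c d (Suc k) x - d * cheb_U c d k x"

lemma continuous_on_cheb_U [continuous_intros]: "continuous_on S (cheb_U c d k)"
proof -
  have "continuous_on S (cheb_U c d k) \<and> continuous_on S (cheb_U c d (Suc k))"
    by (induction k) (auto simp: fun_eq_iff intro!: continuous_intros)
  then show ?thesis ..
qed

text \<open>A scaled form of the classical identity for Chebyshev polynomials of the second kind;
  the recurrence becomes the addition theorem for sin. The abscissa \<open>c - 2 * s * cos t\<close>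
  is chosen to increase on [0, pi] for positive \<open>s\<close>, which costs the sign in
  \<open>(- s) ^ k\<close>.\<close>

lemma sin_mult_cheb_U:
  "sin t * cheb_U c (s\<^sup>2) (Suc k) (c - 2 * s * cos t) = (- s) ^ k * sin (real (Suc k) * t)"
proof (induction k rule: induct_nat_012)
  case 0 then show ?case by simp
next
  case 1
  then show ?case using sin_double[of t] by (simp add: algebra_simps)
next
  case (ge2 k)
  let ?x = "c - 2 * s * cos t"
  let ?r = "real (Suc (Suc k)) * t"
  have "sin t * cheb_U c (s\<^sup>2) (Suc (Suc (Suc k))) ?x =
      - 2 * s * cos t * (sin t * cheb_U c (s\<^sup>2) (Suc (Suc k)) ?x) - s\<^sup>2 * (sin t * cheb_U c (s\<^sup>2) (Suc k) ?x)"
    by (simp add: algebra_simps)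
  also have "\<dots> = (- s) ^ Suc (Suc k) * (2 * cos t * sin ?r - sin (?r - t))"
    unfolding ge2 by (simp add: algebra_simps power2_eq_square)
  also have "2 * cos t * sin ?r - sin (?r - t) = sin (?r + t)"
    by (simp add: sin_add sin_diff)
  also have "?r + t = real (Suc (Suc (Suc k))) * t" by (simp add: algebra_simps)
  finally show ?case .
qed

text \<open>Orthogonality of the sines, needed only against \<open>sin t\<close>, which corresponds
  to the constant polynomial.\<close>

lemma integral_sin_mult_sin_Suc:
  "((\<lambda>t. sin t * sin (real (Suc k) * t)) has_integral (if k = 0 then pi / 2 else 0)) {0..pi}"
proof (cases k)
  case 0
  have "((\<lambda>t. sin t * sin t) has_integral (pi / 2 - sin pi * cos pi / 2) - (0 / 2 - sin 0 * cos 0 / 2)) {0..pi}"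
  proof (rule fundamental_theorem_of_calculus)
    show "((\<lambda>t. t / 2 - sin t * cos t / 2) has_vector_derivative sin t * sin t) (at t within {0..pi})" for t
      unfolding has_real_derivative_iff_has_vector_derivative[symmetric]
    proof -
      have "((\<lambda>t. t / 2 - sin t * cos t / 2) has_real_derivative
          (1 / 2 - (cos t * cos t - sin t * sin t) / 2)) (at t within {0..pi})"
        by (auto intro!: derivative_eq_intros simp: field_simps)
      also have "1 / 2 - (cos t * cos t - sin t * sin t) / 2 = sin t * sin t"
      proof -
        have "cos t * cos t = 1 - sin t * sin t" using sin_cos_squared_add3[of t] by (simp add: eq_diff_eq)
        then show ?thesis by (simp add: field_simps)
      qed
      finally show "((\<lambda>t. t / 2 - sin t * cos t / 2) has_real_derivative sin t * sin t) (at t within {0..pi})" .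
    qed
  qed auto
  then show ?thesis using 0 by simp
next
  case (Suc m)
  \<comment> \<open>Antiderivative of (cos (k t) - cos ((k + 2) t)) / 2, the product formula for the
    integrand. The division by \<open>real k\<close> is why \<open>k = 0\<close> is treated
    apart.\<close>
  define F where "F t = sin (real k * t) / (2 * real k) - sin (real (k + 2) * t) / (2 * real (k + 2))" for t
  have "((\<lambda>t. sin t * sin (real (Suc k) * t)) has_integral F pi - F 0) {0..pi}"
  proof (rule fundamental_theorem_of_calculus)
    show "(F has_vector_derivative sin t * sin (real (Suc k) * t)) (at t within {0..pi})" for t
    proof -
      have "(F has_real_derivative (cos (real k * t) / 2 - cos (real (k + 2) * t) / 2)) (at t within {0..pi})"
      proof -
        have *: "((\<lambda>t. sin (r * t) / (2 * r)) has_real_derivative cos (r * t) / 2) (at t within {0..pi})"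
          if "r \<noteq> 0" for r :: real
          using that by (auto intro!: derivative_eq_intros)
        show ?thesis unfolding F_def using Suc by (intro DERIV_diff *) auto
      qed
      also have "cos (real k * t) / 2 - cos (real (k + 2) * t) / 2 = sin t * sin (real (Suc k) * t)"
      proof -
        have "real k * t = real (Suc k) * t - t" "real (k + 2) * t = real (Suc k) * t + t"
          by (simp_all add: algebra_simps)
        then show ?thesis by (simp only: cos_add cos_diff) (simp add: field_simps)
      qed
      finally show ?thesis by (simp add: has_real_derivative_iff_has_vector_derivative)
    qed
  qed auto
  moreover have "F pi = 0" "F 0 = 0"
    using sin_npi[of k] sin_npi[of "k + 2"] by (simp_all only: F_def) simp_all
  ultimately show ?thesis using Suc by simp
qed

text \<open>Under \<open>x = c - 2 * s * cos t\<close> both the root and the Jacobian become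
  \<open>2 * s * sin t\<close>. One sine is absorbed by \<open>sin_mult_cheb_U\<close>, and
  orthogonality of the sines does the rest.\<close>

lemma has_integral_cheb_U_semicircle:
  assumes s: "s > 0"
  shows "((\<lambda>x. cheb_U c (s\<^sup>2) (Suc k) x * sqrt ((c + 2 * s - x) * (x - (c - 2 * s))))
    has_integral (if k = 0 then 2 * pi * s\<^sup>2 else 0)) {c - 2 * s..c + 2 * s}"
proof -
  define f where "f x = cheb_U c (s\<^sup>2) (Suc k) x * sqrt ((c + 2 * s - x) * (x - (c - 2 * s)))" for x
  define g where "g t = c - 2 * s * cos t" for t
  have cf: "continuous_on {c - 2 * s..c + 2 * s} f"
    unfolding f_def by (intro continuous_intros)
  have "((\<lambda>t. (2 * s * sin t) *\<^sub>R f (g t)) has_integral (integral {g 0..g pi} f)) {0..pi}"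
  proof (rule has_integral_substitution)
    show "g ` {0..pi} \<subseteq> {c - 2 * s..c + 2 * s}"
    proof (clarsimp simp: g_def)
      fix t :: real
      have "s * cos t \<le> s * 1" "s * (-1) \<le> s * cos t" using s by (intro mult_left_mono; simp)+
      then show "s * cos t \<le> s \<and> - (s * cos t) \<le> s" by simp
    qed
    show "(g has_real_derivative 2 * s * sin t) (at t within {0..pi})" for t
      unfolding g_def by (auto intro!: derivative_eq_intros)
  qed (use s cf in \<open>auto simp: g_def\<close>)
  also have "integral {g 0..g pi} f = integral {c - 2 * s..c + 2 * s} f" by (simp add: g_def)
  finally have 1: "((\<lambda>t. (2 * s * sin t) *\<^sub>R f (g t)) has_integral integral {c - 2 * s..c + 2 * s} f) {0..pi}" .
  have eq: "(2 * s * sin t) *\<^sub>R f (g t) = 4 * s\<^sup>2 * (- s) ^ k * (sin t * sin (real (Suc k) * t))"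
    if "t \<in> {0..pi}" for t
  proof -
    have "(c + 2 * s - g t) * (g t - (c - 2 * s)) = (2 * s * sin t)\<^sup>2"
      using sin_cos_squared_add[of t] by (simp add: g_def power_mult_distrib sin_squared_eq) (simp add: power2_eq_square algebra_simps)
    then have "sqrt ((c + 2 * s - g t) * (g t - (c - 2 * s))) = 2 * s * sin t"
      using s that by (simp add: real_sqrt_unique sin_ge_zero)
    then have "(2 * s * sin t) *\<^sub>R f (g t) = 4 * s\<^sup>2 * sin t * (sin t * cheb_U c (s\<^sup>2) (Suc k) (g t))"
      by (simp add: f_def power2_eq_square)
    then show ?thesis unfolding g_def sin_mult_cheb_U by simp
  qed
  have "((\<lambda>t. (2 * s * sin t) *\<^sub>R f (g t)) has_integral 4 * s\<^sup>2 * (- s) ^ k * (if k = 0 then pi / 2 else 0)) {0..pi}"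
    by (rule has_integral_eq[OF _ has_integral_mult_right[OF integral_sin_mult_sin_Suc]]) (rule eq[symmetric])
  with 1 have "integral {c - 2 * s..c + 2 * s} f = 4 * s\<^sup>2 * (- s) ^ k * (if k = 0 then pi / 2 else 0)"
    by (rule has_integral_unique)
  also have "\<dots> = (if k = 0 then 2 * pi * s\<^sup>2 else 0)" by simp
  finally show ?thesis
    using integrable_integral[OF integrable_continuous_real[OF cf]] unfolding f_def by simp
qed

text \<open>For a nonnegative integrand the gauge integral is the Lebesgue integral, so
  integrability comes with the value. This covers integrands unbounded at an endpoint, as happens
  with weight \<open>1 / x\<close> when the support starts at 0.\<close>

lemma has_bochner_integral_lborel_of_has_integral:
  fixes f :: "real \<Rightarrow> real"
  assumes "f \<in> borel_measurable borel" "\<And>x. x \<in> {a..b} \<Longrightarrow> 0 \<le> f x" "(f has_integral I) {a..b}"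
  shows "has_bochner_integral lborel (\<lambda>x. f x * indicator {a..b} x) I"
proof (rule has_bochner_integral_nn_integral)
  have *: "((\<lambda>x. f x * indicator {a..b} x) has_integral I) UNIV"
    using iffD2[OF has_integral_restrict_UNIV assms(3)]
    by (rule has_integral_eq[rotated]) (auto simp: indicator_def)
  show "(\<integral>\<^sup>+x. ennreal (f x * indicator {a..b} x) \<partial>lborel) = ennreal I"
    using assms(1,2) * by (intro nn_integral_has_integral_lborel) (auto simp: indicator_def)
  show "0 \<le> I" using assms(2,3) by (rule has_integral_nonneg[rotated])
qed (use assms in \<open>auto simp: indicator_def\<close>)

subsection \<open>Sums of measures\<close>

text \<open>Serves to split the MANOVA law into its density part and its two atoms, so that
  integrals can be computed part by part. Space and measurable sets come from \<open>M\<close>, so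
  the facts below ask for \<open>sets N = sets M\<close>.\<close>

definition add_measure :: "'a measure \<Rightarrow> 'a measure \<Rightarrow> 'a measure" where
  "add_measure M N = measure_of (space M) (sets M) (\<lambda>S. emeasure M S + emeasure N S)"

lemma sets_add_measure [simp, measurable_cong]: "sets (add_measure M N) = sets M"
  and space_add_measure [simp]: "space (add_measure M N) = space M"
  by (simp_all add: add_measure_def)

lemma emeasure_add_measure:
  assumes "sets N = sets M" "S \<in> sets M"
  shows "emeasure (add_measure M N) S = emeasure M S + emeasure N S"
  unfolding add_measure_def
proof (rule emeasure_measure_of_sigma)
  show "countably_additive (sets M) (\<lambda>S. emeasure M S + emeasure N S)"
    using assms(1)
    by (auto simp: countably_additive_def suminf_add[symmetric] suminf_emeasure)
qed (use assms in \<open>auto simp: positive_def intro: sets.sigma_algebra_axioms\<close>)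

lemma nn_integral_add_measure:
  assumes N: "sets N = sets M" and f: "f \<in> borel_measurable M"
  shows "(\<integral>\<^sup>+x. f x \<partial>add_measure M N) = (\<integral>\<^sup>+x. f x \<partial>M) + (\<integral>\<^sup>+x. f x \<partial>N)"
  using f
proof induction
  case (cong f g)
  have "space N = space M" using N by (rule sets_eq_imp_space_eq)
  then have "integral\<^sup>N K f = integral\<^sup>N K g" if "K \<in> {M, N, add_measure M N}" for K
    using cong(3) that by (intro nn_integral_cong) auto
  with cong(4) show ?case by simp
next
  case (set A)
  then show ?case using N by (simp add: emeasure_add_measure)
next
  case (mult u c)
  moreover have "u \<in> borel_measurable N" "u \<in> borel_measurable (add_measure M N)"
    using mult N by (simp_all cong: measurable_cong_sets)
  ultimately show ?case by (simp add: nn_integral_cmult distrib_left)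
next
  case (add u v)
  moreover have "u \<in> borel_measurable N" "u \<in> borel_measurable (add_measure M N)"
    "v \<in> borel_measurable N" "v \<in> borel_measurable (add_measure M N)"
    using add N by (simp_all cong: measurable_cong_sets)
  ultimately show ?case by (simp add: nn_integral_add ac_simps)
next
  case (seq U)
  moreover have "U i \<in> borel_measurable N" "U i \<in> borel_measurable (add_measure M N)" for i
    using seq N by (simp_all cong: measurable_cong_sets)
  moreover have "incseq (\<lambda>i. \<integral>\<^sup>+x. U i x \<partial>M)" "incseq (\<lambda>i. \<integral>\<^sup>+x. U i x \<partial>N)"
    using seq by (auto simp: incseq_def le_fun_def intro!: nn_integral_mono)
  ultimately show ?case
    by (simp add: nn_integral_monotone_convergence_SUP image_comp ennreal_SUP_add)
qed

lemma has_bochner_integral_add_measure: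
  fixes f :: "'a \<Rightarrow> real"
  assumes N: "sets N = sets M"
    and fM: "has_bochner_integral M f x" and fN: "has_bochner_integral N f y"
  shows "has_bochner_integral (add_measure M N) f (x + y)"
proof -
  have M: "integrable M f" "integral\<^sup>L M f = x" and N': "integrable N f" "integral\<^sup>L N f = y"
    using fM fN by (auto simp: has_bochner_integral_iff)
  have [measurable]: "f \<in> borel_measurable M" using M by auto
  have [measurable]: "f \<in> borel_measurable (add_measure M N)" by (simp cong: measurable_cong_sets)
  have fin: "(\<integral>\<^sup>+x. ennreal (norm (f x)) \<partial>M) < \<infinity>" "(\<integral>\<^sup>+x. ennreal (norm (f x)) \<partial>N) < \<infinity>"
    using M(1) N'(1) by (auto simp: integrable_iff_bounded)
  have int: "integrable (add_measure M N) f"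
    using fin N by (auto simp: integrable_iff_bounded nn_integral_add_measure)
  \<comment> \<open>Meant for \<open>f\<close> and \<open>- f\<close>, the positive and negative
    parts. The bound by \<open>norm (f x)\<close> makes both integrals finite, so that
    \<open>enn2real\<close> is additive on them.\<close>
  have part: "enn2real (\<integral>\<^sup>+x. ennreal (g x) \<partial>add_measure M N) =
      enn2real (\<integral>\<^sup>+x. ennreal (g x) \<partial>M) + enn2real (\<integral>\<^sup>+x. ennreal (g x) \<partial>N)"
    if [measurable]: "g \<in> borel_measurable M" and g: "\<And>x. g x \<le> norm (f x)" for g
  proof -
    have "(\<integral>\<^sup>+x. ennreal (g x) \<partial>M) < \<infinity>" "(\<integral>\<^sup>+x. ennreal (g x) \<partial>N) < \<infinity>"
      by (rule le_less_trans[OF nn_integral_mono fin(1)], rule ennreal_leI, rule g,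
          rule le_less_trans[OF nn_integral_mono fin(2)], rule ennreal_leI, rule g)
    then show ?thesis using N by (simp add: nn_integral_add_measure enn2real_plus)
  qed
  have "integral\<^sup>L (add_measure M N) f = integral\<^sup>L M f + integral\<^sup>L N f"
    using M(1) N'(1) int part[of f] part[of "\<lambda>x. - f x"]
    by (simp add: real_lebesgue_integral_def)
  then show ?thesis using int M N' by (simp add: has_bochner_integral_iff)
qed

text \<open>A continuous factor is bounded on the compact interval \<open>{0..1}\<close>, outside of
  which the product vanishes.\<close>

lemma integrable_continuous_mult:
  assumes p: "continuous_on UNIV p" and f: "integrable lborel f" and supp: "\<And>x. x \<notin> {0..1} \<Longrightarrow> f x = 0"
  shows "integrable lborel (\<lambda>x::real. p x * f x :: real)"
proof -
  have "compact (p ` {0..1})"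
    by (intro compact_continuous_image continuous_on_subset[OF p]) auto
  then obtain K where K: "\<And>x. x \<in> {0..1} \<Longrightarrow> \<bar>p x\<bar> \<le> K"
    by (meson compact_imp_bounded bounded_real imageI)
  have [measurable]: "p \<in> borel_measurable borel" using p by (rule borel_measurable_continuous_onI)
  have [measurable]: "f \<in> borel_measurable borel" using f by auto
  show ?thesis
  proof (rule Bochner_Integration.integrable_bound)
    show "integrable lborel (\<lambda>x. K * \<bar>f x\<bar>)" using f by auto
    show "AE x in lborel. norm (p x * f x) \<le> norm (K * \<bar>f x\<bar>)"
    proof (rule AE_I2)
      fix x show "norm (p x * f x) \<le> norm (K * \<bar>f x\<bar>)"
      proof (cases "x \<in> {0..1}")
        case True
        then have "\<bar>p x\<bar> \<le> \<bar>K\<bar>" using K[of x] by simp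
        then show ?thesis by (simp add: abs_mult mult_right_mono)
      qed (simp add: supp)
    qed
  qed simp
qed

subsection \<open>Moments of the MANOVA law\<close>

locale manova_params =
  fixes \<alpha> \<beta> :: real
  assumes \<alpha>: "0 < \<alpha>" "\<alpha> < 1" and \<beta>: "0 < \<beta>" "\<beta> < 1"
begin

definition c where "c = \<alpha> + \<beta> - 2 * \<alpha> * \<beta>"
definition d where "d = \<alpha> * \<beta> * (1 - \<alpha>) * (1 - \<beta>)"

text \<open>The numerator of the MANOVA density: an unnormalised semicircle weight, cut off outside
  the support.\<close>

definition W where
  "W x = sqrt ((manova_rp \<alpha> \<beta> - x) * (x - manova_rm \<alpha> \<beta>)) * indicator {manova_rm \<alpha> \<beta>..manova_rp \<alpha> \<beta>} x"

lemma d_pos: "d > 0" using \<alpha> \<beta> by (simp add: d_def)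

lemma sqrt_prod_d:
  "sqrt (\<alpha> * (1 - \<beta>)) * sqrt (\<beta> * (1 - \<alpha>)) = sqrt d"
  "sqrt ((1 - \<alpha>) * (1 - \<beta>)) * sqrt (\<alpha> * \<beta>) = sqrt d"
  by (simp_all add: d_def real_sqrt_mult[symmetric] mult_ac)

lemma manova_rp_eq: "manova_rp \<alpha> \<beta> = c + 2 * sqrt d"
  and manova_rm_eq: "manova_rm \<alpha> \<beta> = c - 2 * sqrt d"
  using \<alpha> \<beta> by (simp_all add: manova_rp_def manova_rm_def power2_sum power2_diff mult.assoc sqrt_prod_d)
     (simp_all add: c_def algebra_simps)

lemma manova_rm_nonneg: "0 \<le> manova_rm \<alpha> \<beta>"
  by (simp add: manova_rm_def)

text \<open>The distance from the upper edge to 1 is itself a square, by the same expansion that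
  gives the edges.\<close>

lemma manova_rp_le_1: "manova_rp \<alpha> \<beta> \<le> 1"
proof -
  have "1 - manova_rp \<alpha> \<beta> = (sqrt ((1 - \<alpha>) * (1 - \<beta>)) - sqrt (\<alpha> * \<beta>))\<^sup>2"
    using \<alpha> \<beta> by (simp add: manova_rp_eq power2_diff mult.assoc sqrt_prod_d) (simp add: c_def algebra_simps)
  then show ?thesis by (metis zero_le_power2 diff_ge_0_iff_ge)
qed

lemma manova_rm_less_rp: "manova_rm \<alpha> \<beta> < manova_rp \<alpha> \<beta>"
  using d_pos by (simp add: manova_rp_eq manova_rm_eq)

text \<open>The products are \<open>c\<^sup>2 - 4 * d\<close> and
  \<open>(1 - c)\<^sup>2 - 4 * d\<close>, which are perfect squares. They are also the discriminants
  of z^2 + c z + d and z^2 - (1 - c) z + d, whose roots are therefore polynomial in \<alpha> and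
  \<beta>.\<close>

lemma sqrt_manova_edges:
  "sqrt (manova_rm \<alpha> \<beta> * manova_rp \<alpha> \<beta>) = \<bar>\<alpha> - \<beta>\<bar>"
  "sqrt ((1 - manova_rm \<alpha> \<beta>) * (1 - manova_rp \<alpha> \<beta>)) = \<bar>\<alpha> + \<beta> - 1\<bar>"
proof -
  have *: "(sqrt d)\<^sup>2 = d" using d_pos by simp
  have "manova_rm \<alpha> \<beta> * manova_rp \<alpha> \<beta> = c\<^sup>2 - 4 * (sqrt d)\<^sup>2"
    by (simp add: manova_rp_eq manova_rm_eq power2_eq_square algebra_simps)
  also have "\<dots> = (\<alpha> - \<beta>)\<^sup>2" unfolding * by (simp add: c_def d_def power2_eq_square algebra_simps)
  finally show "sqrt (manova_rm \<alpha> \<beta> * manova_rp \<alpha> \<beta>) = \<bar>\<alpha> - \<beta>\<bar>" by simp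
  have "(1 - manova_rm \<alpha> \<beta>) * (1 - manova_rp \<alpha> \<beta>) = (1 - c)\<^sup>2 - 4 * (sqrt d)\<^sup>2"
    by (simp add: manova_rp_eq manova_rm_eq power2_eq_square algebra_simps)
  also have "\<dots> = (\<alpha> + \<beta> - 1)\<^sup>2" unfolding * by (simp add: c_def d_def power2_eq_square algebra_simps)
  finally show "sqrt ((1 - manova_rm \<alpha> \<beta>) * (1 - manova_rp \<alpha> \<beta>)) = \<bar>\<alpha> + \<beta> - 1\<bar>" by simp
qed

section \<open>The semicircle weight and the functionals built from it\<close>

lemma W_measurable [measurable]: "W \<in> borel_measurable borel"
  unfolding W_def by measurable

text \<open>Includes the points 0 and 1, so cancelling \<open>x\<close> or \<open>1 - x\<close>
  against the weight is valid everywhere, also where division by zero yields 0.\<close>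

lemma W_eq_0: "x \<notin> {0<..<1} \<Longrightarrow> W x = 0"
  using manova_rm_nonneg manova_rp_le_1 by (auto simp: W_def indicator_def)

lemma W_nonneg: "0 \<le> W x"
  by (auto simp: W_def indicator_def)

lemma has_bochner_integral_W_over_x:
  "has_bochner_integral lborel (\<lambda>x. W x / x) (pi * (c - \<bar>\<alpha> - \<beta>\<bar>))"
proof -
  have "((\<lambda>x. sqrt ((manova_rp \<alpha> \<beta> - x) * (x - manova_rm \<alpha> \<beta>)) / x) has_integral
    pi * ((manova_rm \<alpha> \<beta> + manova_rp \<alpha> \<beta>) / 2 - sqrt (manova_rm \<alpha> \<beta> * manova_rp \<alpha> \<beta>)))
    {manova_rm \<alpha> \<beta>..manova_rp \<alpha> \<beta>}"
    by (intro has_integral_sqrt_quadratic_over_x manova_rm_nonneg manova_rm_less_rp)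
  moreover have "(manova_rm \<alpha> \<beta> + manova_rp \<alpha> \<beta>) / 2 = c" by (simp add: manova_rp_eq manova_rm_eq)
  ultimately have "has_bochner_integral lborel
      (\<lambda>x. sqrt ((manova_rp \<alpha> \<beta> - x) * (x - manova_rm \<alpha> \<beta>)) / x * indicator {manova_rm \<alpha> \<beta>..manova_rp \<alpha> \<beta>} x)
      (pi * (c - \<bar>\<alpha> - \<beta>\<bar>))"
    using manova_rm_nonneg
    by (intro has_bochner_integral_lborel_of_has_integral) (auto simp: sqrt_manova_edges)
  then show ?thesis by (simp add: W_def)
qed

lemma has_bochner_integral_W_over_one_minus_x:
  "has_bochner_integral lborel (\<lambda>x. W x / (1 - x)) (pi * (1 - c - \<bar>\<alpha> + \<beta> - 1\<bar>))"
proof -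
  have "((\<lambda>x. sqrt ((manova_rp \<alpha> \<beta> - x) * (x - manova_rm \<alpha> \<beta>)) / (1 - x)) has_integral
    pi * (1 - (manova_rm \<alpha> \<beta> + manova_rp \<alpha> \<beta>) / 2 - sqrt ((1 - manova_rm \<alpha> \<beta>) * (1 - manova_rp \<alpha> \<beta>))))
    {manova_rm \<alpha> \<beta>..manova_rp \<alpha> \<beta>}"
    by (intro has_integral_sqrt_quadratic_over_one_minus_x manova_rp_le_1 manova_rm_less_rp)
  moreover have "(manova_rm \<alpha> \<beta> + manova_rp \<alpha> \<beta>) / 2 = c" by (simp add: manova_rp_eq manova_rm_eq)
  ultimately have "has_bochner_integral lborel
      (\<lambda>x. sqrt ((manova_rp \<alpha> \<beta> - x) * (x - manova_rm \<alpha> \<beta>)) / (1 - x) * indicator {manova_rm \<alpha> \<beta>..manova_rp \<alpha> \<beta>} x)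
      (pi * (1 - c - \<bar>\<alpha> + \<beta> - 1\<bar>))"
    using manova_rp_le_1
    by (intro has_bochner_integral_lborel_of_has_integral) (auto simp: sqrt_manova_edges)
  then show ?thesis by (simp add: W_def)
qed

text \<open>The factor \<open>2 * pi\<close> makes \<open>I0 p + I1 p\<close> the integral of
  \<open>p\<close> against the absolutely continuous part of the MANOVA law. \<open>IW\<close> is
  what remains of either functional after a factor of \<open>p\<close> has cancelled its
  pole.\<close>

definition I0 where "I0 p = (\<integral>x. p x * (W x / x) \<partial>lborel) / (2 * pi)"
definition I1 where "I1 p = (\<integral>x. p x * (W x / (1 - x)) \<partial>lborel) / (2 * pi)"
definition IW where "IW p = (\<integral>x. p x * W x \<partial>lborel) / (2 * pi)"

lemma integrable_W_over_x:
  assumes "continuous_on UNIV p"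
  shows "integrable lborel (\<lambda>x. p x * (W x / x))" "integrable lborel (\<lambda>x. p x * (W x / (1 - x)))"
proof -
  have W: "W x = 0" if "x \<notin> {0..1}" for x using that by (intro W_eq_0) auto
  show "integrable lborel (\<lambda>x. p x * (W x / x))"
    by (rule integrable_continuous_mult[OF assms integrable.intros[OF has_bochner_integral_W_over_x]])
      (subst W; simp)
  show "integrable lborel (\<lambda>x. p x * (W x / (1 - x)))"
    by (rule integrable_continuous_mult[OF assms integrable.intros[OF has_bochner_integral_W_over_one_minus_x]])
      (subst W; simp)
qed

lemma I0_mult_x: "I0 (\<lambda>x. x * p x) = IW p"
  unfolding I0_def IW_def by (rule arg_cong[where f = "\<lambda>i. i / (2 * pi)"], rule Bochner_Integration.integral_cong)
    (auto simp: W_eq_0)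

lemma I1_mult_one_minus_x: "I1 (\<lambda>x. (1 - x) * p x) = IW p"
  unfolding I1_def IW_def
proof (rule arg_cong[where f = "\<lambda>i. i / (2 * pi)"], rule Bochner_Integration.integral_cong)
  show "(1 - x) * p x * (W x / (1 - x)) = p x * W x" for x
    by (cases "x = 1") (auto simp: W_eq_0)
qed auto

lemma I_linear:
  assumes "continuous_on UNIV p" "continuous_on UNIV q"
  shows "I0 (\<lambda>x. a * p x + b * q x) = a * I0 p + b * I0 q"
    "I1 (\<lambda>x. a * p x + b * q x) = a * I1 p + b * I1 q"
proof -
  have *: "(\<integral>x. (a * p x + b * q x) * w x \<partial>lborel) / (2 * pi)
      = a * ((\<integral>x. p x * w x \<partial>lborel) / (2 * pi)) + b * ((\<integral>x. q x * w x \<partial>lborel) / (2 * pi))"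
    if "integrable lborel (\<lambda>x. p x * w x)" "integrable lborel (\<lambda>x. q x * w x)" for w
    using that by (simp add: distrib_right mult.assoc add_divide_distrib)
  show "I0 (\<lambda>x. a * p x + b * q x) = a * I0 p + b * I0 q"
    unfolding I0_def by (rule *) (intro integrable_W_over_x assms)+
  show "I1 (\<lambda>x. a * p x + b * q x) = a * I1 p + b * I1 q"
    unfolding I1_def by (rule *) (intro integrable_W_over_x assms)+
qed

abbreviation U where "U k \<equiv> cheb_U c d k"

text \<open>\<open>U (Suc k)\<close> has degree \<open>k\<close> and is orthogonal to the constant
  \<open>U (Suc 0)\<close> unless \<open>k = 0\<close>; the value \<open>d\<close> is the normalised
  mass of the weight.\<close>

lemma IW_U: "IW (U (Suc k)) = (if k = 0 then d else 0)"
proof -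
  have sd: "sqrt d > 0" "(sqrt d)\<^sup>2 = d" using d_pos by auto
  \<comment> \<open>Integrability against \<open>W\<close> is borrowed from that against
    \<open>W x / x\<close>, with \<open>x * U (Suc k) x\<close> as the continuous factor.\<close>
  have cont: "continuous_on UNIV (\<lambda>x. x * U (Suc k) x)" by (intro continuous_intros)
  have eq: "x * U (Suc k) x * (W x / x) = U (Suc k) x * W x" for x by (cases "x = 0") (auto simp: W_eq_0)
  have "integrable lborel (\<lambda>x. U (Suc k) x * W x)"
    using integrable_W_over_x(1)[OF cont] by (simp only: eq)
  from has_integral_integral_lborel[OF this]
  have "((\<lambda>x. U (Suc k) x * W x) has_integral (\<integral>x. U (Suc k) x * W x \<partial>lborel)) UNIV" .
  moreover have "((\<lambda>x. U (Suc k) x * W x) has_integral (if k = 0 then 2 * pi * d else 0)) UNIV"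
  proof -
    have "((\<lambda>x. U (Suc k) x * sqrt ((manova_rp \<alpha> \<beta> - x) * (x - manova_rm \<alpha> \<beta>)))
      has_integral (if k = 0 then 2 * pi * d else 0)) {manova_rm \<alpha> \<beta>..manova_rp \<alpha> \<beta>}"
      using has_integral_cheb_U_semicircle[OF sd(1), of c k] unfolding sd(2) manova_rp_eq manova_rm_eq .
    then have "((\<lambda>x. if x \<in> {manova_rm \<alpha> \<beta>..manova_rp \<alpha> \<beta>} then
        U (Suc k) x * sqrt ((manova_rp \<alpha> \<beta> - x) * (x - manova_rm \<alpha> \<beta>)) else 0)
      has_integral (if k = 0 then 2 * pi * d else 0)) UNIV"
      by (simp only: has_integral_restrict_UNIV)
    then show ?thesis
      by (rule has_integral_eq[rotated]) (auto simp: W_def indicator_def)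
  qed
  ultimately have "(\<integral>x. U (Suc k) x * W x \<partial>lborel) = (if k = 0 then 2 * pi * d else 0)"
    by (rule has_integral_unique)
  then show ?thesis by (simp add: IW_def)
qed

text \<open>The roots of smaller modulus of \<open>z\<^sup>2 + c z + d\<close> and \<open>z\<^sup>2 - (1 - c) z + d\<close>.\<close>

definition l0 where "l0 = (if \<beta> \<le> \<alpha> then - (1 - \<alpha>) * \<beta> else - \<alpha> * (1 - \<beta>))"
definition l1 where "l1 = (if 1 \<le> \<alpha> + \<beta> then (1 - \<alpha>) * (1 - \<beta>) else \<alpha> * \<beta>)"

lemma l0_root: "l0\<^sup>2 = - c * l0 - d"
  and l1_root: "l1\<^sup>2 = (1 - c) * l1 - d"
  by (simp_all add: l0_def l1_def c_def d_def power2_eq_square algebra_simps)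

lemma I0_one: "I0 (\<lambda>x. 1) = - l0"
proof -
  have "I0 (\<lambda>x. 1) = (c - \<bar>\<alpha> - \<beta>\<bar>) / 2"
    using has_bochner_integral_W_over_x by (simp add: I0_def has_bochner_integral_iff)
  also have "\<dots> = - l0" by (simp add: l0_def c_def algebra_simps)
  finally show ?thesis .
qed

lemma I1_one: "I1 (\<lambda>x. 1) = l1"
proof -
  have "I1 (\<lambda>x. 1) = (1 - c - \<bar>\<alpha> + \<beta> - 1\<bar>) / 2"
    using has_bochner_integral_W_over_one_minus_x by (simp add: I1_def has_bochner_integral_iff)
  also have "\<dots> = l1" by (simp add: l1_def c_def algebra_simps)
  finally show ?thesis .
qed

text \<open>The factor \<open>x - c\<close> of the recurrence is split as \<open>x\<close> minus a
  constant for \<open>I0\<close> and as \<open>- (1 - x)\<close> plus a constant for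
  \<open>I1\<close>, so that one part cancels the pole. The factors 1 and -1 are written out to
  match \<open>I_linear\<close>.\<close>

lemma cheb_U_Suc_Suc:
  "U (Suc (Suc k)) = (\<lambda>x. 1 * (x * U (Suc k) x) + 1 * (- c * U (Suc k) x + - d * U k x))"
  "U (Suc (Suc k)) = (\<lambda>x. (-1) * ((1 - x) * U (Suc k) x) + 1 * ((1 - c) * U (Suc k) x + - d * U k x))"
  by (auto simp: fun_eq_iff algebra_simps)

lemma I_U_rec:
  "I0 (U (Suc (Suc k))) = IW (U (Suc k)) - c * I0 (U (Suc k)) - d * I0 (U k)"
  "I1 (U (Suc (Suc k))) = - IW (U (Suc k)) + (1 - c) * I1 (U (Suc k)) - d * I1 (U k)"
  by (subst cheb_U_Suc_Suc(1) cheb_U_Suc_Suc(2), subst I_linear, intro continuous_intros, intro continuous_intros,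
      subst I_linear, intro continuous_intros, intro continuous_intros, simp add: I0_mult_x I1_mult_one_minus_x)+

lemma U_0_1: "U 0 = (\<lambda>x. 0)" "U (Suc 0) = (\<lambda>x. 1)" by (auto simp: fun_eq_iff)

lemma I_U_0: "I0 (U 0) = 0" "I1 (U 0) = 0"
  by (simp_all add: U_0_1 I0_def I1_def)

text \<open>The recurrence has characteristic polynomial z^2 + c z + d, and its inhomogeneous term
  occurs only at the first step. There the value \<open>d\<close> of \<open>IW\<close> makes up for
  \<open>I0 (U 0)\<close> being 0 rather than -1, so the sequence is exactly geometric with the root
  \<open>l0\<close>. The same mechanism gives \<open>I1_U\<close>.\<close>

lemma I0_U: "I0 (U (Suc k)) = - (l0 ^ Suc k)"
proof (induction k rule: induct_nat_012)
  case 0 then show ?case by (simp add: U_0_1 I0_one)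
next
  case 1 then show ?case
    using l0_root by (simp add: I_U_rec IW_U I_U_0 del: cheb_U.simps) (simp add: U_0_1 I0_one power2_eq_square)
next
  case (ge2 k)
  have "I0 (U (Suc (Suc (Suc k)))) = - (l0 ^ Suc k) * (- c * l0 - d)"
    unfolding I_U_rec(1)[of "Suc k"] ge2 IW_U by (simp add: algebra_simps)
  then show ?case unfolding l0_root[symmetric] by (simp add: power2_eq_square mult_ac del: cheb_U.simps)
qed

lemma I1_U: "I1 (U (Suc k)) = l1 ^ Suc k"
proof (induction k rule: induct_nat_012)
  case 0 then show ?case by (simp add: U_0_1 I1_one)
next
  case 1 then show ?case
    using l1_root by (simp add: I_U_rec IW_U I_U_0 del: cheb_U.simps) (simp add: U_0_1 I1_one power2_eq_square)
next
  case (ge2 k)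
  have "I1 (U (Suc (Suc (Suc k)))) = l1 ^ Suc k * ((1 - c) * l1 - d)"
    unfolding I_U_rec(2)[of "Suc k"] ge2 IW_U by (simp add: algebra_simps)
  then show ?case unfolding l1_root[symmetric] by (simp add: power2_eq_square mult_ac del: cheb_U.simps)
qed

text \<open>For projections \<open>A\<close>, \<open>B\<close> and \<open>C = (A - \<alpha>) (B - \<beta>)\<close>, the compression \<open>A C\<^sup>k A\<close> is
  \<open>Q k\<close> evaluated at \<open>A B A\<close>.\<close>

fun Q :: "nat \<Rightarrow> real \<Rightarrow> real" where
  "Q 0 x = 1"
| "Q (Suc 0) x = (1 - \<alpha>) * (x - \<beta>)"
| "Q (Suc (Suc k)) x = (x - c) * Q (Suc k) x - d * Q k x"

lemma continuous_on_Q [continuous_intros]: "continuous_on S (Q k)"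
proof -
  have "continuous_on S (Q k) \<and> continuous_on S (Q (Suc k))"
    by (induction k) (auto simp: fun_eq_iff intro!: continuous_intros)
  then show ?thesis ..
qed

text \<open>Both sides obey the same three-term recurrence, so the agreement of the first two terms
  suffices.\<close>

lemma Q_Suc_eq_U: "Q (Suc k) x = (1 - \<alpha>) * (x - \<beta>) * U (Suc k) x - d * U k x"
proof (induction k rule: induct_nat_012)
  case (ge2 k)
  have "Q (Suc (Suc (Suc k))) x = (x - c) * Q (Suc (Suc k)) x - d * Q (Suc k) x" by simp
  also have "\<dots> = (1 - \<alpha>) * (x - \<beta>) * ((x - c) * U (Suc (Suc k)) x - d * U (Suc k) x)
      - d * ((x - c) * U (Suc k) x - d * U k x)"
    unfolding ge2 by (simp only: algebra_simps)
  finally show ?case by simp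
qed (simp_all add: algebra_simps)

text \<open>At a fixed point the recurrence has constant coefficients. At 0 the starting value of
  \<open>Q (Suc 0)\<close> is already a characteristic root, so only one geometric sequence appears;
  likewise at 1.\<close>

lemma Q_at_0: "Q k 0 = (- (1 - \<alpha>) * \<beta>) ^ k"
proof (induction k rule: induct_nat_012)
  case (ge2 k)
  have "Q (Suc (Suc k)) 0 = (- (1 - \<alpha>) * \<beta>) ^ k * (- c * (- (1 - \<alpha>) * \<beta>) - d)"
    unfolding Q.simps ge2 by (simp add: algebra_simps)
  also have "- c * (- (1 - \<alpha>) * \<beta>) - d = (- (1 - \<alpha>) * \<beta>)\<^sup>2"
    by (simp add: c_def d_def power2_eq_square algebra_simps)
  finally show ?case by (simp add: power2_eq_square mult_ac)
qed (simp_all add: algebra_simps)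

lemma Q_at_1: "Q k 1 = ((1 - \<alpha>) * (1 - \<beta>)) ^ k"
proof (induction k rule: induct_nat_012)
  case (ge2 k)
  have "Q (Suc (Suc k)) 1 = ((1 - \<alpha>) * (1 - \<beta>)) ^ k * ((1 - c) * ((1 - \<alpha>) * (1 - \<beta>)) - d)"
    unfolding Q.simps ge2 by (simp add: algebra_simps)
  also have "(1 - c) * ((1 - \<alpha>) * (1 - \<beta>)) - d = ((1 - \<alpha>) * (1 - \<beta>))\<^sup>2"
    by (simp add: c_def d_def power2_eq_square algebra_simps)
  finally show ?case by (simp add: power2_eq_square mult_ac)
qed (simp_all add: algebra_simps)

text \<open>Integration against the MANOVA law with \<open>(1 - \<alpha>)\<close> of its mass at \<open>0\<close> removed. This is the limit of
  the normalised trace on the range of \<open>A\<close>, which has relative dimension \<open>\<alpha>\<close>.\<close>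

definition \<Lambda> :: "(real \<Rightarrow> real) \<Rightarrow> real" where
  "\<Lambda> p = I0 p + I1 p + max (\<alpha> - \<beta>) 0 * p 0 + max (\<alpha> + \<beta> - 1) 0 * p 1"

lemma \<Lambda>_linear:
  assumes "continuous_on UNIV p" "continuous_on UNIV q"
  shows "\<Lambda> (\<lambda>x. a * p x + b * q x) = a * \<Lambda> p + b * \<Lambda> q"
  using I_linear[OF assms] by (simp add: \<Lambda>_def algebra_simps)

lemma \<Lambda>_one: "\<Lambda> (\<lambda>x. 1) = \<alpha>"
  by (cases "\<beta> \<le> \<alpha>"; cases "1 \<le> \<alpha> + \<beta>") (simp_all add: \<Lambda>_def I0_one I1_one l0_def l1_def algebra_simps)

text \<open>At each edge the two characteristic roots have product \<open>d\<close>. If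
  \<open>l0\<close> or \<open>l1\<close> is the root other than the value of
  \<open>Q (Suc 0)\<close> there, the left side vanishes, and so does the atom; if it is the same
  root, the difference from the other root is the atom's mass up to sign.\<close>

lemma l0_l1_cases:
  "(- (1 - \<alpha>) * \<beta>) * l0 - d = max (\<alpha> - \<beta>) 0 * (- (1 - \<alpha>) * \<beta>)"
  "(1 - \<alpha>) * (1 - \<beta>) * l1 - d = - max (\<alpha> + \<beta> - 1) 0 * ((1 - \<alpha>) * (1 - \<beta>))"
  by (simp_all add: l0_def l1_def d_def max_def) (simp_all add: algebra_simps)

text \<open>The two \<open>IW\<close> terms cancel. What is left of \<open>I0\<close> and
  \<open>I1\<close> vanishes unless the law has the corresponding atom in \<open>\<Lambda>\<close>,
  and then it is minus the contribution of that atom.\<close>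

lemma \<Lambda>_Q: "\<Lambda> (Q (Suc k)) = 0"
proof -
  let ?l = "- (1 - \<alpha>) * \<beta>" and ?h = "(1 - \<alpha>) * (1 - \<beta>)"
  \<comment> \<open>The factor \<open>(1 - \<alpha>) * (x - \<beta>)\<close> is expanded around 0
    and around 1; \<open>?l\<close> and \<open>?h\<close> are its values there.\<close>
  have Q0: "Q (Suc k) = (\<lambda>x. (1 - \<alpha>) * (x * U (Suc k) x) + 1 * (?l * U (Suc k) x + - d * U k x))"
    and Q1: "Q (Suc k) = (\<lambda>x. - (1 - \<alpha>) * ((1 - x) * U (Suc k) x) + 1 * (?h * U (Suc k) x + - d * U k x))"
    by (auto simp: fun_eq_iff Q_Suc_eq_U algebra_simps simp del: cheb_U.simps)
  have e0: "I0 (Q (Suc k)) = (1 - \<alpha>) * IW (U (Suc k)) + ?l * I0 (U (Suc k)) - d * I0 (U k)"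
    by (subst Q0, subst I_linear, intro continuous_intros, intro continuous_intros,
      subst I_linear, intro continuous_intros, intro continuous_intros, simp add: I0_mult_x)
  have e1: "I1 (Q (Suc k)) = - (1 - \<alpha>) * IW (U (Suc k)) + ?h * I1 (U (Suc k)) - d * I1 (U k)"
    by (subst Q1, subst I_linear, intro continuous_intros, intro continuous_intros,
      subst I_linear, intro continuous_intros, intro continuous_intros, simp add: I1_mult_one_minus_x)
  show ?thesis
  proof (cases k)
    case 0
    \<comment> \<open>For \<open>k = 0\<close> the terms with \<open>U 0\<close> are absent, so the
      \<open>- d\<close> is added and subtracted to reach the shape of \<open>l0_l1_cases\<close>;
      this works only for the sum of the two functionals.\<close>
    have "I0 (Q (Suc k)) + I1 (Q (Suc k)) = - (?l * l0 - d) + (?h * l1 - d)"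
      using 0 unfolding e0 e1 I0_U I1_U by (simp add: I_U_0 algebra_simps del: cheb_U.simps)
    then show ?thesis unfolding l0_l1_cases \<Lambda>_def Q_at_0 Q_at_1 using 0 by simp
  next
    case (Suc m)
    have "(I0 (Q (Suc k)) = - (?l * l0 - d) * l0 ^ k)"
      unfolding e0 using IW_U[of k] Suc by (simp add: I0_U del: cheb_U.simps) (simp add: algebra_simps)
    moreover have "I1 (Q (Suc k)) = (?h * l1 - d) * l1 ^ k"
      unfolding e1 using IW_U[of k] Suc by (simp add: I1_U del: cheb_U.simps) (simp add: algebra_simps)
    \<comment> \<open>Either the atom is absent and both sides are 0, or the root of smaller modulus
      is the value of \<open>Q (Suc 0)\<close> at the atom.\<close>
    moreover have "max (\<alpha> - \<beta>) 0 * l0 ^ k = max (\<alpha> - \<beta>) 0 * ?l ^ k"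
      by (simp add: l0_def)
    moreover have "max (\<alpha> + \<beta> - 1) 0 * l1 ^ k = max (\<alpha> + \<beta> - 1) 0 * ?h ^ k"
      by (simp add: l1_def)
    ultimately have J: "I0 (Q (Suc k)) = - ?l * (max (\<alpha> - \<beta>) 0 * ?l ^ k)"
      "I1 (Q (Suc k)) = - ?h * (max (\<alpha> + \<beta> - 1) 0 * ?h ^ k)"
      unfolding l0_l1_cases by (metis (no_types, opaque_lifting) mult.assoc mult.commute mult_minus_left)+
    have cancel: "- l * (m * lk) + - h * (n * hk) + m * (l * lk) + n * (h * hk) = 0" for l m lk h n hk :: real
      by simp
    show ?thesis
      unfolding \<Lambda>_def Q_at_0 Q_at_1 power_Suc J by (rule cancel)
  qed
qed

text \<open>\<open>measure_of\<close> depends only on the set function on the sigma-algebra.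
  Exhibiting that function as the \<open>emeasure\<close> of an actual measure, with atoms as
  weighted point masses, settles its countable additivity.\<close>

lemma MANOVA_eq_add_measure:
  "MANOVA \<alpha> \<beta> = add_measure (add_measure (density lborel (\<lambda>x. ennreal (manova_density \<alpha> \<beta> x)))
      (density (return borel 0) (\<lambda>x. ennreal (1 - min \<alpha> \<beta>))))
      (density (return borel 1) (\<lambda>x. ennreal (max (\<alpha> + \<beta> - 1) 0)))" (is "_ = ?M")
proof -
  have "measure_of UNIV (sets borel)
     (\<lambda>S. emeasure (density lborel (\<lambda>x. ennreal (manova_density \<alpha> \<beta> x))) S
          + ennreal (1 - min \<alpha> \<beta>) * indicator S 0
          + ennreal (max (\<alpha> + \<beta> - 1) 0) * indicator S 1)
    = measure_of UNIV (sets borel) (emeasure ?M)"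
  proof (rule measure_of_eq)
    fix S :: "real set" assume "S \<in> sigma_sets UNIV (sets borel)"
    then have S: "S \<in> sets borel" by (metis sets.sigma_sets_eq space_borel)
    then show "emeasure (density lborel (\<lambda>x. ennreal (manova_density \<alpha> \<beta> x))) S
          + ennreal (1 - min \<alpha> \<beta>) * indicator S 0
          + ennreal (max (\<alpha> + \<beta> - 1) 0) * indicator S 1 = emeasure ?M S"
      by (simp add: emeasure_add_measure emeasure_density nn_integral_return nn_integral_cmult)
  qed simp
  also have "\<dots> = ?M"
    using measure_of_of_measure[of ?M] by simp
  finally show ?thesis unfolding MANOVA_def .
qed

lemma manova_density_eq: "manova_density \<alpha> \<beta> x = (W x / x + W x / (1 - x)) / (2 * pi)"
proof (cases "x \<in> {0<..<1}")
  case True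
  then have "manova_density \<alpha> \<beta> x = W x / (x * (1 - x)) / (2 * pi)"
    by (simp add: manova_density_def W_def)
  also have "W x / (x * (1 - x)) = W x / x + W x / (1 - x)"
    using True by (simp add: field_simps)
  finally show ?thesis .
next
  case False
  have "manova_density \<alpha> \<beta> x = W x / (2 * pi * x * (1 - x))"
    by (simp add: manova_density_def W_def)
  then show ?thesis using W_eq_0[OF False] by simp
qed

text \<open>The atom at 0 is split as \<open>1 - min \<alpha> \<beta> = (1 - \<alpha>) + max
  (\<alpha> - \<beta>) 0\<close>, the second share being the one in \<open>\<Lambda>\<close>. The
  extra term disappears for functions vanishing at 0, in particular for positive powers.\<close>

lemma has_bochner_integral_MANOVA:
  assumes p: "continuous_on UNIV p"
  shows "has_bochner_integral (MANOVA \<alpha> \<beta>) p (\<Lambda> p + (1 - \<alpha>) * p 0)"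
proof -
  have [measurable]: "p \<in> borel_measurable borel" using p by (rule borel_measurable_continuous_onI)
  have [measurable]: "manova_density \<alpha> \<beta> \<in> borel_measurable borel"
    unfolding manova_density_def by measurable
  have nonneg: "0 \<le> manova_density \<alpha> \<beta> x" for x
    using W_nonneg[of x] W_eq_0[of x] unfolding manova_density_eq by (cases "x \<in> {0<..<1}") auto
  have "has_bochner_integral lborel (\<lambda>x. manova_density \<alpha> \<beta> x *\<^sub>R p x) (I0 p + I1 p)"
  proof -
    have "has_bochner_integral lborel (\<lambda>x. (p x * (W x / x) + p x * (W x / (1 - x))) / (2 * pi)) (I0 p + I1 p)"
      unfolding I0_def I1_def add_divide_distrib[symmetric]
      by (intro has_bochner_integral_divide_zero has_bochner_integral_add has_bochner_integral_integrable
          integrable_W_over_x p)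
    then show ?thesis by (simp add: manova_density_eq algebra_simps)
  qed
  then have 1: "has_bochner_integral (density lborel (\<lambda>x. ennreal (manova_density \<alpha> \<beta> x))) p (I0 p + I1 p)"
    by (intro has_bochner_integral_density) (auto simp: nonneg)
  have 2: "has_bochner_integral (density (return borel y) (\<lambda>x. ennreal w)) p (w * p y)" if "0 \<le> w" for y w :: real
  proof (rule has_bochner_integral_density)
    have "integrable (return borel y) (\<lambda>x. w *\<^sub>R p x)"
      by (simp add: integrable_iff_bounded nn_integral_return)
    then show "has_bochner_integral (return borel y) (\<lambda>x. w *\<^sub>R p x) (w * p y)"
      by (simp add: has_bochner_integral_iff integral_return)
  qed (use that in auto)
  have "has_bochner_integral (MANOVA \<alpha> \<beta>) p
      ((I0 p + I1 p + (1 - min \<alpha> \<beta>) * p 0) + max (\<alpha> + \<beta> - 1) 0 * p 1)"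
    unfolding MANOVA_eq_add_measure
    by (intro has_bochner_integral_add_measure 1 2) (use \<alpha> \<beta> in auto)
  also have "(I0 p + I1 p + (1 - min \<alpha> \<beta>) * p 0) + max (\<alpha> + \<beta> - 1) 0 * p 1 = \<Lambda> p + (1 - \<alpha>) * p 0"
    by (auto simp: \<Lambda>_def min_def max_def algebra_simps)
  finally show ?thesis .
qed

end

subsection \<open>Traces of words in two idempotents\<close>

lemma mat_tr_add: "X \<in> carrier_mat n n \<Longrightarrow> Y \<in> carrier_mat n n \<Longrightarrow> mat_tr (X + Y) = mat_tr X + mat_tr Y"
  by (simp add: mat_tr_def sum.distrib)

lemma mat_tr_minus: "X \<in> carrier_mat n n \<Longrightarrow> Y \<in> carrier_mat n n \<Longrightarrow> mat_tr (X - Y) = mat_tr X - mat_tr Y"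
  by (simp add: mat_tr_def sum_subtractf)

lemma mat_tr_smult: "X \<in> carrier_mat n n \<Longrightarrow> mat_tr (x \<cdot>\<^sub>m X) = x * mat_tr X"
  by (simp add: mat_tr_def sum_distrib_left)

lemma mat_tr_one: "mat_tr (1\<^sub>m n) = of_nat n"
  by (simp add: mat_tr_def)

lemma mat_tr_comm:
  assumes "X \<in> carrier_mat n n" "Y \<in> carrier_mat n n"
  shows "mat_tr (X * Y) = mat_tr (Y * X)"
proof -
  have "mat_tr (X * Y) = (\<Sum>i<n. \<Sum>j<n. X $$ (i, j) * Y $$ (j, i))"
    using assms by (simp add: mat_tr_def scalar_prod_def lessThan_atLeast0)
  also have "\<dots> = (\<Sum>j<n. \<Sum>i<n. X $$ (i, j) * Y $$ (j, i))" by (rule sum.swap)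
  also have "\<dots> = mat_tr (Y * X)"
    using assms by (simp add: mat_tr_def scalar_prod_def lessThan_atLeast0 mult.commute)
  finally show ?thesis .
qed

lemma pow_mat_Suc_left:
  assumes "X \<in> carrier_mat n n"
  shows "X ^\<^sub>m Suc k = X * X ^\<^sub>m k"
proof (induction k)
  case (Suc k)
  have "X ^\<^sub>m Suc (Suc k) = X * X ^\<^sub>m k * X" using Suc by simp
  also have "\<dots> = X * X ^\<^sub>m Suc k" using assms by (simp add: assoc_mult_mat[of _ n n _ n _ n])
  finally show ?case .
qed (use assms in simp)

text \<open>This is A C^k A Y^m, to be matched with Q_k(Y) Y^m on the range of \<open>A\<close>. The
  index \<open>m\<close> is present because the recurrence in \<open>k\<close> produces a further
  factor Y. Bracketing to the right lets \<open>C\<close> act on a matrix fixed by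
  \<open>A\<close>.\<close>

definition compressed_word ::
    "nat \<Rightarrow> complex mat \<Rightarrow> complex mat \<Rightarrow> complex \<Rightarrow> complex \<Rightarrow> nat \<Rightarrow> nat \<Rightarrow> complex mat" where
  "compressed_word n A B \<alpha> \<beta> k m =
    A * (((A - \<alpha> \<cdot>\<^sub>m 1\<^sub>m n) * (B - \<beta> \<cdot>\<^sub>m 1\<^sub>m n)) ^\<^sub>m k * (A * (A * B * A) ^\<^sub>m m))"

locale two_idempotents =
  fixes n :: nat and A B :: "complex mat" and \<alpha> \<beta> :: complex
  assumes A: "A \<in> carrier_mat n n" and B: "B \<in> carrier_mat n n"
    and AA: "A * A = A" and BB: "B * B = B"
begin

abbreviation a where "a \<equiv> A - \<alpha> \<cdot>\<^sub>m 1\<^sub>m n"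
abbreviation b where "b \<equiv> B - \<beta> \<cdot>\<^sub>m 1\<^sub>m n"
abbreviation C where "C \<equiv> a * b"
abbreviation Y where "Y \<equiv> A * B * A"

lemma sq_closed [simp]:
  "X \<in> carrier_mat n n \<Longrightarrow> Z \<in> carrier_mat n n \<Longrightarrow> X * Z \<in> carrier_mat n n"
  "X \<in> carrier_mat n n \<Longrightarrow> Z \<in> carrier_mat n n \<Longrightarrow> X - Z \<in> carrier_mat n n"
  "X \<in> carrier_mat n n \<Longrightarrow> Z \<in> carrier_mat n n \<Longrightarrow> X + Z \<in> carrier_mat n n"
  for X Z :: "complex mat"
  by auto

lemmas sq_assoc = assoc_mult_mat[of _ n n _ n _ n]
lemmas sq_distrib = mult_minus_distrib_mat[of _ n n _ n] mult_add_distrib_mat[of _ n n _ n]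
  mult_smult_distrib[of _ n n _ n]

lemma carr [simp]: "A \<in> carrier_mat n n" "B \<in> carrier_mat n n" "a \<in> carrier_mat n n" "b \<in> carrier_mat n n"
  "C \<in> carrier_mat n n" "Y \<in> carrier_mat n n"
  using A B by simp_all

lemma dims [simp]: "dim_row A = n" "dim_col A = n" "dim_row B = n" "dim_col B = n"
  using carrier_matD[OF A] carrier_matD[OF B] by simp_all

lemma C_mult: "X \<in> carrier_mat n n \<Longrightarrow> C * X = a * (b * X)"
  by (simp add: sq_assoc)

lemma a_mult: "X \<in> carrier_mat n n \<Longrightarrow> a * X = A * X - \<alpha> \<cdot>\<^sub>m X"
  and b_mult: "X \<in> carrier_mat n n \<Longrightarrow> b * X = B * X - \<beta> \<cdot>\<^sub>m X"
  by (simp_all add: minus_mult_distrib_mat[of _ n n _ _ n] mult_smult_assoc_mat[of _ n n _ n])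

lemma AA_mult: "X \<in> carrier_mat n n \<Longrightarrow> A * (A * X) = A * X"
  and BB_mult: "X \<in> carrier_mat n n \<Longrightarrow> B * (B * X) = B * X"
  using AA BB by (simp_all flip: sq_assoc)

text \<open>An idempotent shifted by \<alpha> is annihilated by the quadratic with roots - \<alpha>
  and 1 - \<alpha>.\<close>

lemma aa_mult:
  assumes "X \<in> carrier_mat n n"
  shows "a * (a * X) = (1 - 2 * \<alpha>) \<cdot>\<^sub>m (a * X) + (\<alpha> * (1 - \<alpha>)) \<cdot>\<^sub>m X"
  using assms
  by (simp add: a_mult sq_distrib AA_mult)
    (rule eq_matI, auto simp: algebra_simps simp del: index_mult_mat(1))

lemma bb_mult:
  assumes "X \<in> carrier_mat n n"
  shows "b * (b * X) = (1 - 2 * \<beta>) \<cdot>\<^sub>m (b * X) + (\<beta> * (1 - \<beta>)) \<cdot>\<^sub>m X"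
  using assms
  by (simp add: b_mult sq_distrib BB_mult)
    (rule eq_matI, auto simp: algebra_simps simp del: index_mult_mat(1))

text \<open>On the range of \<open>A\<close>, the defect \<open>Y - c - C\<close> equals \<open>\<alpha> (B - (1 - \<beta>))\<close>, which \<open>C\<close>
  maps to a scalar because \<open>(B - \<beta>) (B - (1 - \<beta>))\<close> is scalar.\<close>

lemma C_C_mult:
  assumes X: "X \<in> carrier_mat n n" and AX: "A * X = X"
  shows "C * (C * X) = C * (Y * X) - (\<alpha> + \<beta> - 2 * \<alpha> * \<beta>) \<cdot>\<^sub>m (C * X)
    - (\<alpha> * \<beta> * (1 - \<alpha>) * (1 - \<beta>)) \<cdot>\<^sub>m X"
proof -
  define D where "D = \<alpha> \<cdot>\<^sub>m (B * X - (1 - \<beta>) \<cdot>\<^sub>m X)"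
  have D: "D \<in> carrier_mat n n" using X by (simp add: D_def)
  have YX: "Y * X = A * (B * X)" using X AX by (simp add: sq_assoc)
  have CX: "C * X = A * (B * X) - \<beta> \<cdot>\<^sub>m X - \<alpha> \<cdot>\<^sub>m (B * X) + (\<alpha> * \<beta>) \<cdot>\<^sub>m X"
    unfolding C_mult[OF X] using X AX
    by (simp add: a_mult b_mult sq_distrib)
      (rule eq_matI, auto simp: algebra_simps simp del: index_mult_mat(1))
  have 1: "Y * X = C * X + (\<alpha> + \<beta> - 2 * \<alpha> * \<beta>) \<cdot>\<^sub>m X + D"
    unfolding YX CX D_def using X
    by (intro eq_matI) (auto simp: algebra_simps simp del: index_mult_mat(1))
  have "b * D = (\<alpha> * \<beta> * (1 - \<beta>)) \<cdot>\<^sub>m X"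
    unfolding D_def using X
    by (simp add: b_mult sq_distrib BB_mult)
      (rule eq_matI, auto simp: algebra_simps simp del: index_mult_mat(1))
  \<comment> \<open>Since \<open>A * X = X\<close>, the left factor \<open>a\<close> acts on
    \<open>X\<close> as the scalar 1 - \<alpha>.\<close>
  then have 2: "C * D = (\<alpha> * \<beta> * (1 - \<alpha>) * (1 - \<beta>)) \<cdot>\<^sub>m X"
    unfolding C_mult[OF D] using X AX
    by (simp add: a_mult sq_distrib)
      (rule eq_matI, auto simp: algebra_simps simp del: index_mult_mat(1))
  have "C * (Y * X) = C * (C * X) + (\<alpha> + \<beta> - 2 * \<alpha> * \<beta>) \<cdot>\<^sub>m (C * X) + C * D"
    unfolding 1 using X D
    by (simp add: sq_distrib del: assoc_mult_mat)
  then show ?thesis unfolding 2 using X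
    by (intro eq_matI) (auto simp: algebra_simps simp del: index_mult_mat(1) assoc_mult_mat)
qed

abbreviation R where "R \<equiv> compressed_word n A B \<alpha> \<beta>"

lemma R_def: "R k m = A * (C ^\<^sub>m k * (A * Y ^\<^sub>m m))"
  by (simp add: compressed_word_def)

lemma Y_AY: "Y * (A * Y ^\<^sub>m m) = A * Y ^\<^sub>m Suc m" "A * (B * (A * Y ^\<^sub>m m)) = A * Y ^\<^sub>m Suc m"
  unfolding pow_mat_Suc_left[OF carr(6)] by (simp_all add: sq_assoc AA_mult)

text \<open>\<open>C_C_mult\<close> is applied to the two innermost factors \<open>C\<close>, which
  act on a matrix fixed by \<open>A\<close>; the factor \<open>Y\<close> it creates is absorbed into
  the power on the right.\<close>

lemma R_rec:
  "R (Suc (Suc k)) m = R (Suc k) (Suc m) - (\<alpha> + \<beta> - 2 * \<alpha> * \<beta>) \<cdot>\<^sub>m R (Suc k) m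
    - (\<alpha> * \<beta> * (1 - \<alpha>) * (1 - \<beta>)) \<cdot>\<^sub>m R k m"
proof -
  define X where "X = A * Y ^\<^sub>m m"
  have X: "X \<in> carrier_mat n n" by (simp add: X_def)
  have AX: "A * X = X" by (simp add: X_def AA_mult)
  have "R (Suc (Suc k)) m = A * (C ^\<^sub>m k * (C * (C * X)))"
    unfolding R_def X_def[symmetric] using X by (simp only: pow_mat.simps) (simp add: sq_assoc)
  also have "\<dots> = A * (C ^\<^sub>m k * (C * (Y * X))) - (\<alpha> + \<beta> - 2 * \<alpha> * \<beta>) \<cdot>\<^sub>m (A * (C ^\<^sub>m k * (C * X)))
     - (\<alpha> * \<beta> * (1 - \<alpha>) * (1 - \<beta>)) \<cdot>\<^sub>m (A * (C ^\<^sub>m k * X))"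
    unfolding C_C_mult[OF X AX] using X
    by (simp add: sq_distrib del: assoc_mult_mat)
  also have "Y * X = A * Y ^\<^sub>m Suc m" unfolding X_def by (rule Y_AY)
  finally show ?thesis
    unfolding R_def X_def by (simp add: sq_assoc)
qed

lemma R_1: "R (Suc 0) m = (1 - \<alpha>) \<cdot>\<^sub>m R 0 (Suc m) - ((1 - \<alpha>) * \<beta>) \<cdot>\<^sub>m R 0 m"
proof -
  define X where "X = A * Y ^\<^sub>m m"
  have X: "X \<in> carrier_mat n n" by (simp add: X_def)
  have AX: "A * X = X" by (simp add: X_def AA_mult)
  have R0: "R 0 k = A * Y ^\<^sub>m k" for k
    unfolding R_def by (simp add: AA_mult left_mult_one_mat[of _ n n])
  have "R (Suc 0) m = A * (C * X)"
    unfolding R_def X_def[symmetric] using X by (simp add: sq_assoc)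
  also have "\<dots> = (1 - \<alpha>) \<cdot>\<^sub>m (A * (B * X)) - ((1 - \<alpha>) * \<beta>) \<cdot>\<^sub>m X"
    unfolding C_mult[OF X] using X AX
    by (simp add: a_mult b_mult sq_distrib AA_mult)
      (rule eq_matI, auto simp: algebra_simps simp del: index_mult_mat(1))
  finally show ?thesis unfolding R0 X_def Y_AY .
qed

lemma R_carrier [simp]: "R k m \<in> carrier_mat n n"
  by (simp add: R_def)

lemma mat_tr_R_rec:
  "mat_tr (R (Suc (Suc k)) m) = mat_tr (R (Suc k) (Suc m)) - (\<alpha> + \<beta> - 2 * \<alpha> * \<beta>) * mat_tr (R (Suc k) m)
    - (\<alpha> * \<beta> * (1 - \<alpha>) * (1 - \<beta>)) * mat_tr (R k m)"
  by (simp add: R_rec mat_tr_minus[of _ n] mat_tr_smult[of _ n])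

lemma mat_tr_R_1:
  "mat_tr (R (Suc 0) m) = (1 - \<alpha>) * mat_tr (R 0 (Suc m)) - ((1 - \<alpha>) * \<beta>) * mat_tr (R 0 m)"
  by (simp add: R_1 mat_tr_minus[of _ n] mat_tr_smult[of _ n])

text \<open>The two cases differ because the word with \<open>k = m = 0\<close> is \<open>A\<close>
  and not the identity \<open>Y ^\<^sub>m 0\<close>.\<close>

lemma mat_tr_R_0: "mat_tr (R 0 0) = mat_tr A" "mat_tr (R 0 (Suc m)) = mat_tr (Y ^\<^sub>m Suc m)"
  unfolding R_def pow_mat_Suc_left[OF carr(6)] using AA
  by (simp_all add: sq_assoc AA_mult left_mult_one_mat[of _ n n] right_mult_one_mat[of _ n n])

text \<open>Cyclicity merges the two outer factors \<open>A\<close> into one, which is then written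
  as \<open>a\<close> plus a scalar.\<close>

lemma mat_tr_R_k_0: "mat_tr (R k 0) = mat_tr (a * C ^\<^sub>m k) + \<alpha> * mat_tr (C ^\<^sub>m k)"
proof -
  have "mat_tr (R k 0) = mat_tr (C ^\<^sub>m k * A * A)"
    unfolding R_def using mat_tr_comm[of A n "C ^\<^sub>m k * A"] by (simp add: right_mult_one_mat[of _ n n])
  also have "C ^\<^sub>m k * A * A = C ^\<^sub>m k * A" using AA by (simp add: sq_assoc)
  also have "mat_tr (C ^\<^sub>m k * A) = mat_tr (A * C ^\<^sub>m k)" by (rule mat_tr_comm[of _ n]) simp_all
  also have "\<dots> = mat_tr (a * C ^\<^sub>m k) + \<alpha> * mat_tr (C ^\<^sub>m k)"
    by (simp add: a_mult mat_tr_minus[of _ n] mat_tr_smult[of _ n])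
  finally show ?thesis .
qed

text \<open>The word starts with \<open>a * a\<close>, which is affine in \<open>a\<close>. Together
  with \<open>mat_tr_b_pow\<close>, where cyclicity brings the last \<open>b\<close> to the front,
  this alternates between \<open>a\<close> and \<open>b\<close> while lowering the exponent, up to
  traces of powers of \<open>C\<close>.\<close>

lemma mat_tr_a_pow:
  "mat_tr (a * C ^\<^sub>m Suc k) = (1 - 2 * \<alpha>) * mat_tr (C ^\<^sub>m Suc k) + (\<alpha> * (1 - \<alpha>)) * mat_tr (b * C ^\<^sub>m k)"
proof -
  have "a * C ^\<^sub>m Suc k = a * (a * (b * C ^\<^sub>m k))"
    unfolding pow_mat_Suc_left[OF carr(5)] by (simp add: sq_assoc)
  also have "\<dots> = (1 - 2 * \<alpha>) \<cdot>\<^sub>m (C ^\<^sub>m Suc k) + (\<alpha> * (1 - \<alpha>)) \<cdot>\<^sub>m (b * C ^\<^sub>m k)"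
    unfolding pow_mat_Suc_left[OF carr(5)] by (simp add: aa_mult sq_assoc)
  finally show ?thesis by (simp add: mat_tr_add[of _ n] mat_tr_smult[of _ n] del: pow_mat.simps)
qed

lemma mat_tr_b_pow:
  "mat_tr (b * C ^\<^sub>m Suc k) = (1 - 2 * \<beta>) * mat_tr (C ^\<^sub>m Suc k) + (\<beta> * (1 - \<beta>)) * mat_tr (a * C ^\<^sub>m k)"
proof -
  have "mat_tr (b * C ^\<^sub>m Suc k) = mat_tr (b * (C ^\<^sub>m k * a) * b)" by (simp add: sq_assoc)
  also have "\<dots> = mat_tr (b * (b * (C ^\<^sub>m k * a)))" by (rule mat_tr_comm[of _ n]) simp_all
  also have "\<dots> = (1 - 2 * \<beta>) * mat_tr (b * (C ^\<^sub>m k * a)) + (\<beta> * (1 - \<beta>)) * mat_tr (C ^\<^sub>m k * a)"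
    by (simp add: bb_mult mat_tr_add[of _ n] mat_tr_smult[of _ n])
  also have "mat_tr (b * (C ^\<^sub>m k * a)) = mat_tr (C ^\<^sub>m k * a * b)" by (rule mat_tr_comm[of _ n]) simp_all
  also have "C ^\<^sub>m k * a * b = C ^\<^sub>m Suc k" by (simp add: sq_assoc)
  also have "mat_tr (C ^\<^sub>m k * a) = mat_tr (a * C ^\<^sub>m k)" by (rule mat_tr_comm[of _ n]) simp_all
  finally show ?thesis .
qed

end

subsection \<open>Moments of the empirical spectral distribution\<close>

lemma index_mat_adjoint:
  assumes "X \<in> carrier_mat n n" "mat_adjoint X = X" "i < n" "j < n"
  shows "X $$ (j, i) = cnj (X $$ (i, j))"
proof -
  have "X $$ (j, i) = mat_adjoint X $$ (j, i)" using assms by simp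
  also have "\<dots> = cnj (X $$ (i, j))"
    using assms(1,3,4) by (simp add: mat_adjoint_def mat_of_rows_def)
  finally show ?thesis .
qed

lemmas cnj_index_hermitian = index_mat_adjoint[symmetric]

lemma mat_adjointI:
  assumes "X \<in> carrier_mat n n" "\<And>i j. i < n \<Longrightarrow> j < n \<Longrightarrow> cnj (X $$ (i, j)) = X $$ (j, i)"
  shows "mat_adjoint X = X"
  using assms by (intro eq_matI) (auto simp: mat_adjoint_def mat_of_rows_def)

section \<open>Traces of powers as power sums of eigenvalues\<close>

lemma upper_triangular_pow:
  fixes T :: "complex mat"
  assumes T: "T \<in> carrier_mat n n" "upper_triangular T"
  shows "upper_triangular (T ^\<^sub>m k) \<and> (\<forall>i<n. (T ^\<^sub>m k) $$ (i, i) = (T $$ (i, i)) ^ k)"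
proof (induction k)
  case 0
  show ?case using T by (auto simp: upper_triangular_def)
next
  case (Suc k)
  let ?S = "T ^\<^sub>m k"
  have S: "?S \<in> carrier_mat n n" using T by simp
  have ent: "(?S * T) $$ (i, j) = (\<Sum>l\<in>{0..<n}. ?S $$ (i, l) * T $$ (l, j))" if "i < n" "j < n" for i j
    using that S T by (simp add: scalar_prod_def)
  have S0: "?S $$ (i, l) = 0" if "l < i" "i < n" for i l
    using Suc S that by (auto simp: upper_triangular_def)
  have T0: "T $$ (i, l) = 0" if "l < i" "i < n" for i l
    using T that by (auto simp: upper_triangular_def)
  have "(?S * T) $$ (i, j) = 0" if "j < i" "i < n" for i j
  proof -
    have "?S $$ (i, l) * T $$ (l, j) = 0" if "l < n" for l
      using S0[of l i] T0[of j l] \<open>j < i\<close> \<open>i < n\<close> that by (cases "l < i") auto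
    then show ?thesis using that by (subst ent) (auto intro!: sum.neutral)
  qed
  moreover have "(?S * T) $$ (i, i) = T $$ (i, i) ^ Suc k" if "i < n" for i
  proof -
    have "(?S * T) $$ (i, i) = (\<Sum>l\<in>{0..<n}. if l = i then ?S $$ (i, i) * T $$ (i, i) else 0)"
      unfolding ent[OF that that]
    proof (rule sum.cong)
      fix l assume "l \<in> {0..<n}"
      then show "?S $$ (i, l) * T $$ (l, i) = (if l = i then ?S $$ (i, i) * T $$ (i, i) else 0)"
        using S0[of l i] T0[of i l] that by (cases l i rule: linorder_cases) auto
    qed simp
    also have "\<dots> = T $$ (i, i) ^ Suc k" using that Suc by simp
    finally show ?thesis .
  qed
  ultimately show ?case using T by (simp add: upper_triangular_def del: index_mult_mat(1))
qed

text \<open>Schur decomposition: the trace is invariant under similarity, and a power of a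
  triangular matrix has the powers of the eigenvalues on its diagonal.\<close>

lemma mat_tr_pow_eq_sum_list:
  fixes H :: "complex mat"
  assumes H: "H \<in> carrier_mat n n" and es: "char_poly H = (\<Prod>e\<leftarrow>es. [:- e, 1:])"
  shows "mat_tr (H ^\<^sub>m k) = (\<Sum>e\<leftarrow>es. e ^ k)"
proof -
  obtain T P Q where dec: "schur_decomposition H es = (T, P, Q)" by (cases "schur_decomposition H es") auto
  from schur_decomposition[OF H es dec]
  have wit: "similar_mat_wit H T P Q" and ut: "upper_triangular T" and diag: "diag_mat T = es" by auto
  from similar_mat_witD2[OF H wit]
  have T: "T \<in> carrier_mat n n" by simp
  have Hk: "H ^\<^sub>m k \<in> carrier_mat n n" using H by simp
  note w = similar_mat_witD2[OF Hk similar_mat_wit_pow[OF wit]]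
  have "mat_tr (H ^\<^sub>m k) = mat_tr (P * T ^\<^sub>m k * Q)" using w(3) by simp
  also have "\<dots> = mat_tr (Q * (P * T ^\<^sub>m k))" using w by (intro mat_tr_comm[of _ n]) auto
  also have "Q * (P * T ^\<^sub>m k) = (Q * P) * T ^\<^sub>m k"
    using w by (intro assoc_mult_mat[symmetric, of _ n n _ n _ n]) auto
  also have "\<dots> = T ^\<^sub>m k" unfolding w(2) using T by simp
  also have "mat_tr (T ^\<^sub>m k) = (\<Sum>i<n. T $$ (i, i) ^ k)"
    using upper_triangular_pow[OF T ut, of k] T by (simp add: mat_tr_def)
  also have "\<dots> = (\<Sum>e\<leftarrow>es. e ^ k)"
    using T unfolding diag[symmetric] diag_mat_def
    by (simp add: o_def sum_list_sum_nth lessThan_atLeast0)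
  finally show ?thesis .
qed

text \<open>For an eigenvector \<open>v\<close> the form \<open>q\<close> = v* H v is real by
  hermitian symmetry and equals \<open>e\<close> times the squared norm of \<open>v\<close>.\<close>

lemma hermitian_eigenvalue_real:
  fixes H :: "complex mat"
  assumes H: "H \<in> carrier_mat n n" "mat_adjoint H = H" and root: "poly (char_poly H) e = 0"
  shows "e \<in> \<real>"
proof -
  from root obtain v where v: "v \<in> carrier_vec n" "v \<noteq> 0\<^sub>v n" "H *\<^sub>v v = e \<cdot>\<^sub>v v"
    using eigenvalue_root_char_poly[OF H(1)] H(1) by (auto simp: eigenvalue_def eigenvector_def)
  define s where "s = (\<Sum>i<n. (cmod (v $ i))\<^sup>2)"
  define q where "q = (\<Sum>i<n. \<Sum>j<n. cnj (v $ i) * H $$ (i, j) * v $ j)"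
  have "s \<noteq> 0"
  proof
    assume "s = 0"
    then have "v $ i = 0" if "i < n" for i
      using that unfolding s_def by (subst (asm) sum_nonneg_eq_0_iff) auto
    then have "v = 0\<^sub>v n" using v(1) by (intro eq_vecI) auto
    with v(2) show False by simp
  qed
  have "q = (\<Sum>i<n. cnj (v $ i) * (H *\<^sub>v v) $ i)"
    unfolding q_def using H(1) v(1)
    by (intro sum.cong) (auto simp: scalar_prod_def sum_distrib_left lessThan_atLeast0 mult.assoc)
  also have "\<dots> = (\<Sum>i<n. e * of_real ((cmod (v $ i))\<^sup>2))"
    using v by (intro sum.cong) (auto simp: complex_norm_square mult_ac simp del: of_real_power)
  also have "\<dots> = e * of_real s" by (simp add: s_def sum_distrib_left)
  finally have q: "q = e * of_real s" .
  have "cnj q = (\<Sum>i<n. \<Sum>j<n. v $ i * H $$ (j, i) * cnj (v $ j))"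
    unfolding q_def by (simp add: cnj_index_hermitian[OF H])
  also have "\<dots> = (\<Sum>j<n. \<Sum>i<n. v $ i * H $$ (j, i) * cnj (v $ j))" by (rule sum.swap)
  also have "\<dots> = q" by (simp add: q_def mult_ac)
  finally have "cnj e * of_real s = e * of_real s" unfolding q by simp
  with \<open>s \<noteq> 0\<close> have "cnj e = e" by simp
  then show ?thesis by (simp add: Reals_cnj_iff)
qed

text \<open>Presents the spectral distribution as the image of a finite weighted point measure,
  which turns its integrals into finite sums.\<close>

lemma esd_eq_distr:
  assumes H: "H \<in> carrier_mat n n" "n > 0"
  defines "F \<equiv> {x::real. poly (char_poly H) (complex_of_real x) = 0}"
  shows "finite F"
    "esd H = distr (point_measure F (\<lambda>x. real (Polynomial.order (complex_of_real x) (char_poly H)) / real n))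
      borel (\<lambda>x. x)"
proof -
  have nz: "char_poly H \<noteq> 0" using degree_monic_char_poly[OF H(1)] by auto
  have "finite (complex_of_real ` F)"
    by (rule finite_subset[OF _ poly_roots_finite[OF nz]]) (auto simp: F_def)
  then show fin: "finite F" by (rule finite_imageD) (auto simp: inj_on_def)
  let ?w = "\<lambda>x. real (Polynomial.order (complex_of_real x) (char_poly H)) / real n"
  let ?D = "distr (point_measure F ?w) borel (\<lambda>x. x)"
  have "measure_of UNIV (sets borel) (\<lambda>S. ennreal (\<Sum>x \<in> F \<inter> S. ?w x)) = measure_of UNIV (sets borel) (emeasure ?D)"
  proof (rule measure_of_eq)
    fix S :: "real set" assume "S \<in> sigma_sets UNIV (sets borel)"
    then have S: "S \<in> sets borel" by (metis sets.sigma_sets_eq space_borel)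
    have "emeasure ?D S = emeasure (point_measure F ?w) (F \<inter> S)"
      using S by (subst emeasure_distr) (auto simp: space_point_measure sets_point_measure measurable_def Int_commute)
    also have "\<dots> = (\<Sum>x\<in>F \<inter> S. ennreal (?w x))" using fin by (intro emeasure_point_measure_finite) auto
    also have "\<dots> = ennreal (\<Sum>x \<in> F \<inter> S. ?w x)" by (intro sum_ennreal) auto
    finally show "ennreal (\<Sum>x \<in> F \<inter> S. ?w x) = emeasure ?D S" by simp
  qed simp
  also have "\<dots> = ?D" using measure_of_of_measure[of ?D] by simp
  finally show "esd H = ?D" using H unfolding esd_def F_def by simp
qed

lemma sum_list_map_eq_sum_count_superset:
  fixes f :: "'a \<Rightarrow> 'b::comm_semiring_1"
  assumes "finite S" "set xs \<subseteq> S"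
  shows "(\<Sum>x\<leftarrow>xs. f x) = (\<Sum>x\<in>S. of_nat (count_list xs x) * f x)"
  using assms(2)
proof (induction xs)
  case (Cons y xs)
  have "(\<Sum>x\<in>S. of_nat (count_list (y # xs) x) * f x) =
      (\<Sum>x\<in>S. (if x = y then f y else 0) + of_nat (count_list xs x) * f x)"
    by (intro sum.cong) (auto simp: algebra_simps)
  also have "\<dots> = f y + (\<Sum>x\<in>S. of_nat (count_list xs x) * f x)"
    using Cons.prems assms(1) by (simp add: sum.distrib)
  finally show ?case using Cons by simp
qed simp

lemma integral_esd_power:
  assumes H: "H \<in> carrier_mat n n" "n > 0" "mat_adjoint H = H"
  shows "(\<integral>x. x ^ k \<partial>esd H) = Re (mat_tr (H ^\<^sub>m k)) / real n"
proof -
  define F where "F = {x::real. poly (char_poly H) (complex_of_real x) = 0}"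
  let ?o = "\<lambda>x. Polynomial.order (complex_of_real x) (char_poly H)"
  obtain es where es: "char_poly H = (\<Prod>e\<leftarrow>es. [:- e, 1:])"
    using char_poly_factorized[OF H(1)] by auto
  have ord: "Polynomial.order z (char_poly H) = count_list es z" for z
    unfolding es
  proof (subst order_prod_list)
    show "sum_list (map (Polynomial.order z) (map (\<lambda>e. [:- e, 1:]) es)) = count_list es z"
      by (induction es) (auto simp: order_linear')
  qed auto
  have root: "poly (char_poly H) z = 0 \<longleftrightarrow> z \<in> set es" for z
    unfolding es by (induction es) auto
  \<comment> \<open>Reality of the eigenvalues enters here: \<open>esd\<close> sums over real roots
    only, and none of the roots is lost.\<close>
  have set: "set es = complex_of_real ` F"
  proof
    show "set es \<subseteq> complex_of_real ` F"
    proof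
      fix z assume z: "z \<in> set es"
      then have "z \<in> \<real>" using hermitian_eigenvalue_real[OF H(1,3)] root by auto
      then obtain x where "z = of_real x" by (auto elim: Reals_cases)
      then show "z \<in> complex_of_real ` F" using z root by (auto simp: F_def)
    qed
  qed (auto simp: F_def root)
  have "mat_tr (H ^\<^sub>m k) = (\<Sum>e\<leftarrow>es. e ^ k)" by (rule mat_tr_pow_eq_sum_list[OF H(1) es])
  also have "\<dots> = (\<Sum>e\<in>set es. of_nat (count_list es e) * e ^ k)"
    by (rule sum_list_map_eq_sum_count_superset) auto
  also have "\<dots> = (\<Sum>x\<in>F. of_nat (?o x) * of_real x ^ k)"
    unfolding set by (subst sum.reindex) (auto simp: inj_on_def ord)
  also have "\<dots> = of_real (\<Sum>x\<in>F. real (?o x) * x ^ k)" by simp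
  finally have tr: "Re (mat_tr (H ^\<^sub>m k)) = (\<Sum>x\<in>F. real (?o x) * x ^ k)" by simp
  have "(\<integral>x. x ^ k \<partial>esd H) = (\<integral>x. x ^ k \<partial>point_measure F (\<lambda>x. real (?o x) / real n))"
    unfolding esd_eq_distr(2)[OF H(1,2)] F_def
    by (rule integral_distr) (auto simp: point_measure_def)
  also have "\<dots> = (\<Sum>x\<in>F. (real (?o x) / real n) *\<^sub>R x ^ k)"
    using esd_eq_distr(1)[OF H(1,2)] by (intro lebesgue_integral_point_measure_finite) (auto simp: F_def)
  also have "\<dots> = (\<Sum>x\<in>F. real (?o x) * x ^ k) / real n"
    by (simp add: sum_divide_distrib)
  finally show ?thesis unfolding tr .
qed

text \<open>By P = P P* the squared norm \<open>t\<close> of a row equals its diagonal entry, which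
  is one of the entries of that row. Hence t^2 \<le> t, so t \<le> 1 bounds every entry.\<close>

lemma orth_proj_entry_le_1:
  assumes P: "orth_proj_mat n P" and ij: "i < n" "j < n"
  shows "cmod (P $$ (i, j)) \<le> 1"
proof -
  have c: "P \<in> carrier_mat n n" and PP: "P * P = P" and ad: "mat_adjoint P = P"
    using P by (auto simp: orth_proj_mat_def)
  have row: "P $$ (l, l) = of_real (\<Sum>m<n. (cmod (P $$ (l, m)))\<^sup>2)" if "l < n" for l
  proof -
    have "P $$ (l, l) = (P * P) $$ (l, l)" using PP by simp
    also have "\<dots> = (\<Sum>m<n. P $$ (l, m) * P $$ (m, l))"
      using c that by (simp add: scalar_prod_def lessThan_atLeast0)
    also have "\<dots> = (\<Sum>m<n. of_real ((cmod (P $$ (l, m)))\<^sup>2))"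
      using index_mat_adjoint[OF c ad that] by (intro sum.cong) (auto simp: complex_norm_square simp del: of_real_power)
    finally show ?thesis by simp
  qed
  define t where "t = (\<Sum>m<n. (cmod (P $$ (i, m)))\<^sup>2)"
  have le: "(cmod (P $$ (i, m)))\<^sup>2 \<le> t" if "m < n" for m
    unfolding t_def using that by (intro member_le_sum) auto
  have "t \<ge> 0" unfolding t_def by (intro sum_nonneg) auto
  then have "t\<^sup>2 \<le> t" using le[OF ij(1)] row[OF ij(1)] by (simp add: t_def[symmetric])
  have "t \<le> 1"
  proof (rule ccontr)
    assume "\<not> t \<le> 1"
    then have "t * 1 < t * t" by (intro mult_strict_left_mono) auto
    with \<open>t\<^sup>2 \<le> t\<close> show False by (simp add: power2_eq_square)
  qed
  then have "(cmod (P $$ (i, j)))\<^sup>2 \<le> 1" using le[OF ij(2)] by simp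
  then show ?thesis by (simp add: power2_le_iff_abs_le abs_square_le_1)
qed

lemma hermitian_ABA:
  assumes "orth_proj_mat n A" "orth_proj_mat n B"
  shows "mat_adjoint (A * B * A) = A * B * A"
proof (rule mat_adjointI)
  have A: "A \<in> carrier_mat n n" "mat_adjoint A = A" and B: "B \<in> carrier_mat n n" "mat_adjoint B = B"
    using assms by (auto simp: orth_proj_mat_def)
  show "A * B * A \<in> carrier_mat n n" using A B by auto
  have e: "(A * B * A) $$ (i, j) = (\<Sum>l<n. \<Sum>k<n. A $$ (i, l) * B $$ (l, k) * A $$ (k, j))"
    if "i < n" "j < n" for i j
    using that A B by (simp add: scalar_prod_def lessThan_atLeast0 sum_distrib_left mult.assoc)
  fix i j assume ij: "i < n" "j < n"
  have "cnj ((A * B * A) $$ (i, j)) = (\<Sum>l<n. \<Sum>k<n. A $$ (l, i) * B $$ (k, l) * A $$ (j, k))"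
    unfolding e[OF ij] using ij
    by (simp add: cnj_index_hermitian[OF A] cnj_index_hermitian[OF B])
  also have "\<dots> = (\<Sum>k<n. \<Sum>l<n. A $$ (l, i) * B $$ (k, l) * A $$ (j, k))" by (rule sum.swap)
  also have "\<dots> = (A * B * A) $$ (j, i)" unfolding e[OF ij(2,1)] by (simp add: mult_ac)
  finally show "cnj ((A * B * A) $$ (i, j)) = (A * B * A) $$ (j, i)" .
qed

subsection \<open>Expected traces\<close>

text \<open>Entrywise measurability with a uniform bound: stable under the matrix operations that
  form the words, and enough for the trace to be integrable on a probability space.\<close>

definition bdd_mat_rv :: "nat \<Rightarrow> 'a measure \<Rightarrow> ('a \<Rightarrow> complex mat) \<Rightarrow> bool" where
  "bdd_mat_rv n M F \<longleftrightarrow> (\<forall>\<omega>\<in>space M. F \<omega> \<in> carrier_mat n n) \<and>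
     (\<forall>i<n. \<forall>j<n. (\<lambda>\<omega>. F \<omega> $$ (i, j)) \<in> borel_measurable M) \<and>
     (\<exists>K. \<forall>\<omega>\<in>space M. \<forall>i<n. \<forall>j<n. cmod (F \<omega> $$ (i, j)) \<le> K)"

lemma bdd_mat_rv_carrier: "bdd_mat_rv n M F \<Longrightarrow> \<omega> \<in> space M \<Longrightarrow> F \<omega> \<in> carrier_mat n n"
  by (simp add: bdd_mat_rv_def)

lemma bdd_mat_rvI:
  assumes "\<And>\<omega>. \<omega> \<in> space M \<Longrightarrow> F \<omega> \<in> carrier_mat n n"
    and eq: "\<And>\<omega> i j. \<omega> \<in> space M \<Longrightarrow> i < n \<Longrightarrow> j < n \<Longrightarrow> F \<omega> $$ (i, j) = f i j \<omega>"
    and meas: "\<And>i j. i < n \<Longrightarrow> j < n \<Longrightarrow> f i j \<in> borel_measurable M"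
    and "\<And>\<omega> i j. \<omega> \<in> space M \<Longrightarrow> i < n \<Longrightarrow> j < n \<Longrightarrow> cmod (f i j \<omega>) \<le> K"
  shows "bdd_mat_rv n M F"
proof -
  have "(\<lambda>\<omega>. F \<omega> $$ (i, j)) \<in> borel_measurable M" if "i < n" "j < n" for i j
    using meas[OF that] eq that by (subst measurable_cong[where g = "f i j"]) auto
  moreover have "\<exists>K. \<forall>\<omega>\<in>space M. \<forall>i<n. \<forall>j<n. cmod (F \<omega> $$ (i, j)) \<le> K"
    using assms(4) eq by (intro exI[of _ K]) auto
  ultimately show ?thesis using assms(1) by (simp add: bdd_mat_rv_def)
qed

lemma bdd_mat_rvE:
  assumes "bdd_mat_rv n M F"
  obtains K where "\<And>\<omega> i j. \<omega> \<in> space M \<Longrightarrow> i < n \<Longrightarrow> j < n \<Longrightarrow> cmod (F \<omega> $$ (i, j)) \<le> K"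
    "\<And>i j. i < n \<Longrightarrow> j < n \<Longrightarrow> (\<lambda>\<omega>. F \<omega> $$ (i, j)) \<in> borel_measurable M"
  using assms unfolding bdd_mat_rv_def by blast

lemma bdd_mat_rv_const:
  assumes "X \<in> carrier_mat n n"
  shows "bdd_mat_rv n M (\<lambda>_. X)"
proof (rule bdd_mat_rvI[where f = "\<lambda>i j _. X $$ (i, j)"])
  show "cmod (X $$ (i, j)) \<le> (\<Sum>p\<in>{..<n} \<times> {..<n}. cmod (X $$ p))" if "i < n" "j < n" for i j
    using that by (intro member_le_sum) auto
qed (use assms in auto)

lemma bdd_mat_rv_smult:
  assumes F: "bdd_mat_rv n M F"
  shows "bdd_mat_rv n M (\<lambda>\<omega>. x \<cdot>\<^sub>m F \<omega>)"
proof -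
  obtain K where K: "\<And>\<omega> i j. \<omega> \<in> space M \<Longrightarrow> i < n \<Longrightarrow> j < n \<Longrightarrow> cmod (F \<omega> $$ (i, j)) \<le> K"
    and m: "\<And>i j. i < n \<Longrightarrow> j < n \<Longrightarrow> (\<lambda>\<omega>. F \<omega> $$ (i, j)) \<in> borel_measurable M"
    using F by (rule bdd_mat_rvE) blast
  note F' = bdd_mat_rv_carrier[OF F]
  show ?thesis
  proof (rule bdd_mat_rvI)
    show "(x \<cdot>\<^sub>m F \<omega>) $$ (i, j) = x * F \<omega> $$ (i, j)" if "\<omega> \<in> space M" "i < n" "j < n" for \<omega> i j
      using F'[OF that(1)] that by simp
    show "cmod (x * F \<omega> $$ (i, j)) \<le> cmod x * K" if "\<omega> \<in> space M" "i < n" "j < n" for \<omega> i j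
      using K[OF that] by (simp add: norm_mult mult_left_mono)
  qed (use F' m in auto)
qed

lemma bdd_mat_rv_minus:
  assumes F: "bdd_mat_rv n M F" and G: "bdd_mat_rv n M G"
  shows "bdd_mat_rv n M (\<lambda>\<omega>. F \<omega> - G \<omega>)"
proof -
  obtain K where K: "\<And>\<omega> i j. \<omega> \<in> space M \<Longrightarrow> i < n \<Longrightarrow> j < n \<Longrightarrow> cmod (F \<omega> $$ (i, j)) \<le> K"
    and mF: "\<And>i j. i < n \<Longrightarrow> j < n \<Longrightarrow> (\<lambda>\<omega>. F \<omega> $$ (i, j)) \<in> borel_measurable M"
    using F by (rule bdd_mat_rvE) blast
  obtain L where L: "\<And>\<omega> i j. \<omega> \<in> space M \<Longrightarrow> i < n \<Longrightarrow> j < n \<Longrightarrow> cmod (G \<omega> $$ (i, j)) \<le> L"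
    and mG: "\<And>i j. i < n \<Longrightarrow> j < n \<Longrightarrow> (\<lambda>\<omega>. G \<omega> $$ (i, j)) \<in> borel_measurable M"
    using G by (rule bdd_mat_rvE) blast
  note F' = bdd_mat_rv_carrier[OF F] and G' = bdd_mat_rv_carrier[OF G]
  show ?thesis
  proof (rule bdd_mat_rvI)
    show "F \<omega> - G \<omega> \<in> carrier_mat n n" if "\<omega> \<in> space M" for \<omega>
      using F'[OF that] G'[OF that] by auto
    show "(F \<omega> - G \<omega>) $$ (i, j) = F \<omega> $$ (i, j) - G \<omega> $$ (i, j)" if "\<omega> \<in> space M" "i < n" "j < n" for \<omega> i j
      using G'[OF that(1)] that by simp
    show "cmod (F \<omega> $$ (i, j) - G \<omega> $$ (i, j)) \<le> K + L" if "\<omega> \<in> space M" "i < n" "j < n" for \<omega> i j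
      using norm_triangle_ineq4[of "F \<omega> $$ (i, j)" "G \<omega> $$ (i, j)"] K[OF that] L[OF that] by linarith
  qed (use mF mG in auto)
qed

lemma bdd_mat_rv_mult:
  assumes F: "bdd_mat_rv n M F" and G: "bdd_mat_rv n M G"
  shows "bdd_mat_rv n M (\<lambda>\<omega>. F \<omega> * G \<omega>)"
proof -
  obtain K where K: "\<And>\<omega> i j. \<omega> \<in> space M \<Longrightarrow> i < n \<Longrightarrow> j < n \<Longrightarrow> cmod (F \<omega> $$ (i, j)) \<le> K"
    and mF: "\<And>i j. i < n \<Longrightarrow> j < n \<Longrightarrow> (\<lambda>\<omega>. F \<omega> $$ (i, j)) \<in> borel_measurable M"
    using F by (rule bdd_mat_rvE) blast
  obtain L where L: "\<And>\<omega> i j. \<omega> \<in> space M \<Longrightarrow> i < n \<Longrightarrow> j < n \<Longrightarrow> cmod (G \<omega> $$ (i, j)) \<le> L"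
    and mG: "\<And>i j. i < n \<Longrightarrow> j < n \<Longrightarrow> (\<lambda>\<omega>. G \<omega> $$ (i, j)) \<in> borel_measurable M"
    using G by (rule bdd_mat_rvE) blast
  note F' = bdd_mat_rv_carrier[OF F] and G' = bdd_mat_rv_carrier[OF G]
  show ?thesis
  proof (rule bdd_mat_rvI)
    show "F \<omega> * G \<omega> \<in> carrier_mat n n" if "\<omega> \<in> space M" for \<omega>
      using F'[OF that] G'[OF that] by auto
    show "(F \<omega> * G \<omega>) $$ (i, j) = (\<Sum>l\<in>{0..<n}. F \<omega> $$ (i, l) * G \<omega> $$ (l, j))"
      if "\<omega> \<in> space M" "i < n" "j < n" for \<omega> i j
      using F'[OF that(1)] G'[OF that(1)] that by (simp add: scalar_prod_def)
    show "cmod (\<Sum>l\<in>{0..<n}. F \<omega> $$ (i, l) * G \<omega> $$ (l, j)) \<le> (\<Sum>l\<in>{0..<n}. K * L)"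
      if \<omega>: "\<omega> \<in> space M" "i < n" "j < n" for \<omega> i j
    proof (rule sum_norm_le)
      fix l assume "l \<in> {0..<n}"
      then have "cmod (F \<omega> $$ (i, l)) \<le> K" "cmod (G \<omega> $$ (l, j)) \<le> L" using K L \<omega> by auto
      moreover from this have "0 \<le> K" by (meson norm_ge_zero order_trans)
      ultimately show "cmod (F \<omega> $$ (i, l) * G \<omega> $$ (l, j)) \<le> K * L"
        unfolding norm_mult by (intro mult_mono) auto
    qed
  qed (use mF mG in auto)
qed

lemma bdd_mat_rv_pow:
  assumes F: "bdd_mat_rv n M F"
  shows "bdd_mat_rv n M (\<lambda>\<omega>. F \<omega> ^\<^sub>m k)"
proof (induction k)
  case 0
  show ?case
  proof (rule bdd_mat_rvI)
    fix \<omega> assume \<omega>: "\<omega> \<in> space M"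
    show "F \<omega> ^\<^sub>m 0 \<in> carrier_mat n n" using bdd_mat_rv_carrier[OF F \<omega>] by (rule pow_carrier_mat)
    show "(F \<omega> ^\<^sub>m 0) $$ (i, j) = (if i = j then 1 else 0)" if "i < n" "j < n" for i j
      using bdd_mat_rv_carrier[OF F \<omega>] that by simp
    show "cmod (if i = j then 1 else 0) \<le> 1" if "i < n" "j < n" for i j :: nat by simp
  qed simp
next
  case (Suc k)
  then show ?case using bdd_mat_rv_mult[OF Suc F] by simp
qed

lemmas bdd_mat_rv_intros = bdd_mat_rv_minus bdd_mat_rv_mult bdd_mat_rv_pow bdd_mat_rv_smult bdd_mat_rv_const

lemma bdd_mat_rv_orth_proj:
  assumes "\<And>\<omega>. \<omega> \<in> space M \<Longrightarrow> orth_proj_mat n (F \<omega>)"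
    and "\<And>i j. i < n \<Longrightarrow> j < n \<Longrightarrow> (\<lambda>\<omega>. F \<omega> $$ (i, j)) \<in> borel_measurable M"
  shows "bdd_mat_rv n M F"
proof (rule bdd_mat_rvI)
  show "F \<omega> \<in> carrier_mat n n" if "\<omega> \<in> space M" for \<omega>
    using assms(1)[OF that] by (simp add: orth_proj_mat_def)
qed (use assms orth_proj_entry_le_1[OF assms(1)] in auto)

lemma integrable_mat_tr:
  assumes "prob_space M" and F: "bdd_mat_rv n M F"
  shows "integrable M (\<lambda>\<omega>. mat_tr (F \<omega>))"
proof -
  interpret prob_space M by fact
  obtain K where K: "\<And>\<omega> i j. \<omega> \<in> space M \<Longrightarrow> i < n \<Longrightarrow> j < n \<Longrightarrow> cmod (F \<omega> $$ (i, j)) \<le> K"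
    using F unfolding bdd_mat_rv_def by blast
  have "integrable M (\<lambda>\<omega>. \<Sum>i<n. F \<omega> $$ (i, i))"
    using F K by (intro Bochner_Integration.integrable_sum integrable_const_bound[where B = K] AE_I2)
      (auto simp: bdd_mat_rv_def)
  moreover have "mat_tr (F \<omega>) = (\<Sum>i<n. F \<omega> $$ (i, i))" if "\<omega> \<in> space M" for \<omega>
    using bdd_mat_rv_carrier[OF F that] by (simp add: mat_tr_def)
  ultimately show ?thesis by (simp cong: Bochner_Integration.integrable_cong)
qed

definition etr :: "nat \<Rightarrow> 'a measure \<Rightarrow> ('a \<Rightarrow> complex mat) \<Rightarrow> complex" where
  "etr n M F = (1 / of_nat n) * (\<integral>\<omega>. mat_tr (F \<omega>) \<partial>M)"

text \<open>Transfers pointwise trace identities to expectations. Three summands is the longest case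
  in use; shorter identities are padded with a summand of coefficient 0.\<close>

lemma etr_linear:
  assumes "prob_space M" "bdd_mat_rv n M F" "bdd_mat_rv n M G" "bdd_mat_rv n M H"
    and eq: "\<And>\<omega>. \<omega> \<in> space M \<Longrightarrow> mat_tr (E \<omega>) = p * mat_tr (F \<omega>) + q * mat_tr (G \<omega>) + r * mat_tr (H \<omega>)"
  shows "etr n M E = p * etr n M F + q * etr n M G + r * etr n M H"
proof -
  note [simp] = integrable_mat_tr[OF assms(1,2)] integrable_mat_tr[OF assms(1,3)] integrable_mat_tr[OF assms(1,4)]
  have "(\<integral>\<omega>. mat_tr (E \<omega>) \<partial>M) = (\<integral>\<omega>. p * mat_tr (F \<omega>) + q * mat_tr (G \<omega>) + r * mat_tr (H \<omega>) \<partial>M)"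
    by (rule Bochner_Integration.integral_cong) (auto simp: eq)
  also have "\<dots> = p * (\<integral>\<omega>. mat_tr (F \<omega>) \<partial>M) + q * (\<integral>\<omega>. mat_tr (G \<omega>) \<partial>M) + r * (\<integral>\<omega>. mat_tr (H \<omega>) \<partial>M)"
    by simp
  finally show ?thesis by (simp add: etr_def algebra_simps)
qed

lemma etr_one: "prob_space M \<Longrightarrow> n > 0 \<Longrightarrow> etr n M (\<lambda>_. 1\<^sub>m n) = 1"
  by (simp add: etr_def mat_tr_one prob_space.prob_space)

section \<open>Limits determined by the recurrences\<close>

context manova_params
begin

lemma \<Lambda>_Q_rec:
  "\<Lambda> (\<lambda>x. Q (Suc (Suc k)) x * x ^ m) = \<Lambda> (\<lambda>x. Q (Suc k) x * x ^ Suc m)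
    - c * \<Lambda> (\<lambda>x. Q (Suc k) x * x ^ m) - d * \<Lambda> (\<lambda>x. Q k x * x ^ m)"
proof -
  have "(\<lambda>x. Q (Suc (Suc k)) x * x ^ m) = (\<lambda>x. 1 * (Q (Suc k) x * x ^ Suc m)
      + 1 * (- c * (Q (Suc k) x * x ^ m) + - d * (Q k x * x ^ m)))"
    by (auto simp: fun_eq_iff algebra_simps)
  then show ?thesis
    by (simp only:) (subst \<Lambda>_linear, (intro continuous_intros)+, subst \<Lambda>_linear, (intro continuous_intros)+, simp)
qed

lemma \<Lambda>_Q_1:
  "\<Lambda> (\<lambda>x. Q (Suc 0) x * x ^ m) = (1 - \<alpha>) * \<Lambda> (\<lambda>x. Q 0 x * x ^ Suc m) - (1 - \<alpha>) * \<beta> * \<Lambda> (\<lambda>x. Q 0 x * x ^ m)"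
proof -
  have "(\<lambda>x. Q (Suc 0) x * x ^ m) = (\<lambda>x. (1 - \<alpha>) * (Q 0 x * x ^ Suc m) + - ((1 - \<alpha>) * \<beta>) * (Q 0 x * x ^ m))"
    by (auto simp: fun_eq_iff algebra_simps)
  then show ?thesis
    by (simp only:) (subst \<Lambda>_linear, (intro continuous_intros)+, simp)
qed

text \<open>Both recurrences are solved for the entry with the larger second index, so column
  \<open>m + 1\<close> is a fixed linear function of column \<open>m\<close>, for \<open>r\<close>
  and for its proposed limit alike. Column 0 is given by \<open>base\<close>. For
  \<open>k = 0\<close> the solving divides by 1 - \<alpha>, which is nonzero.\<close>

lemma tendsto_\<Lambda>:
  fixes r :: "nat \<Rightarrow> nat \<Rightarrow> nat \<Rightarrow> complex"
  assumes rec: "\<And>\<iota> k m. r \<iota> (Suc (Suc k)) m = r \<iota> (Suc k) (Suc m) - of_real c * r \<iota> (Suc k) m - of_real d * r \<iota> k m"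
    and rec1: "\<And>\<iota> m. r \<iota> (Suc 0) m = of_real (1 - \<alpha>) * r \<iota> 0 (Suc m) - of_real ((1 - \<alpha>) * \<beta>) * r \<iota> 0 m"
    and base: "(\<lambda>\<iota>. r \<iota> 0 0) \<longlonglongrightarrow> of_real \<alpha>" "\<And>k. (\<lambda>\<iota>. r \<iota> (Suc k) 0) \<longlonglongrightarrow> 0"
  shows "(\<lambda>\<iota>. r \<iota> k m) \<longlonglongrightarrow> of_real (\<Lambda> (\<lambda>x. Q k x * x ^ m))"
proof (induction m arbitrary: k)
  case 0
  show ?case using base \<Lambda>_one \<Lambda>_Q by (cases k) (simp_all del: Q.simps(2,3))
next
  case (Suc m)
  let ?L = "\<lambda>k m. complex_of_real (\<Lambda> (\<lambda>x. Q k x * x ^ m))"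
  show ?case
  proof (cases k)
    case 0
    have nz: "complex_of_real (1 - \<alpha>) \<noteq> 0" using \<alpha> by (simp del: of_real_diff)
    have "(\<lambda>\<iota>. (r \<iota> (Suc 0) m + of_real ((1 - \<alpha>) * \<beta>) * r \<iota> 0 m) / of_real (1 - \<alpha>))
        \<longlonglongrightarrow> (?L (Suc 0) m + of_real ((1 - \<alpha>) * \<beta>) * ?L 0 m) / of_real (1 - \<alpha>)"
      by (intro tendsto_intros Suc nz)
    also have "(\<lambda>\<iota>. (r \<iota> (Suc 0) m + of_real ((1 - \<alpha>) * \<beta>) * r \<iota> 0 m) / of_real (1 - \<alpha>)) = (\<lambda>\<iota>. r \<iota> 0 (Suc m))"
      unfolding rec1 using nz by (auto simp: fun_eq_iff simp del: of_real_diff)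
    also have "(?L (Suc 0) m + of_real ((1 - \<alpha>) * \<beta>) * ?L 0 m) / of_real (1 - \<alpha>) = ?L 0 (Suc m)"
    proof -
      have "?L (Suc 0) m + of_real ((1 - \<alpha>) * \<beta>) * ?L 0 m = of_real (1 - \<alpha>) * ?L 0 (Suc m)"
        unfolding \<Lambda>_Q_1 of_real_mult[symmetric] of_real_add[symmetric] by simp
      then show ?thesis using nz by (simp only: nonzero_mult_div_cancel_left not_False_eq_True)
    qed
    finally show ?thesis using 0 by simp
  next
    case (Suc k')
    have "(\<lambda>\<iota>. r \<iota> (Suc (Suc k')) m + of_real c * r \<iota> (Suc k') m + of_real d * r \<iota> k' m)
        \<longlonglongrightarrow> ?L (Suc (Suc k')) m + of_real c * ?L (Suc k') m + of_real d * ?L k' m"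
      by (intro tendsto_intros Suc.IH)
    also have "(\<lambda>\<iota>. r \<iota> (Suc (Suc k')) m + of_real c * r \<iota> (Suc k') m + of_real d * r \<iota> k' m) = (\<lambda>\<iota>. r \<iota> (Suc k') (Suc m))"
      unfolding rec by (auto simp: fun_eq_iff)
    also have "?L (Suc (Suc k')) m + of_real c * ?L (Suc k') m + of_real d * ?L k' m = ?L (Suc k') (Suc m)"
      unfolding \<Lambda>_Q_rec of_real_mult[symmetric] of_real_add[symmetric] by simp
    finally show ?thesis using Suc by simp
  qed
qed

end

theorem theorem1p5:
  fixes N :: "nat \<Rightarrow> nat"
    and M :: "nat \<Rightarrow> 'a measure"
    and A B :: "nat \<Rightarrow> 'a \<Rightarrow> complex mat"
    and \<alpha> \<beta> :: real
  assumes N_mono: "strict_mono N"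
    and N_pos: "\<And>\<iota>. N \<iota> > 0"
    and prob: "\<And>\<iota>. prob_space (M \<iota>)"
    and A_proj: "\<And>\<iota> \<omega>. \<omega> \<in> space (M \<iota>) \<Longrightarrow> orth_proj_mat (N \<iota>) (A \<iota> \<omega>)"
    and B_proj: "\<And>\<iota> \<omega>. \<omega> \<in> space (M \<iota>) \<Longrightarrow> orth_proj_mat (N \<iota>) (B \<iota> \<omega>)"
    and A_meas: "\<And>\<iota> i j. i < N \<iota> \<Longrightarrow> j < N \<iota> \<Longrightarrow>
                   (\<lambda>\<omega>. A \<iota> \<omega> $$ (i, j)) \<in> borel_measurable (M \<iota>)"
    and B_meas: "\<And>\<iota> i j. i < N \<iota> \<Longrightarrow> j < N \<iota> \<Longrightarrow>
                   (\<lambda>\<omega>. B \<iota> \<omega> $$ (i, j)) \<in> borel_measurable (M \<iota>)"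
    and \<alpha>: "0 < \<alpha>" "\<alpha> < 1"
    and \<beta>: "0 < \<beta>" "\<beta> < 1"
    and trA: "((\<lambda>\<iota>. (1 / of_nat (N \<iota>)) * (\<integral>\<omega>. mat_tr (A \<iota> \<omega>) \<partial>(M \<iota>))
                  - complex_of_real \<alpha>) \<longlongrightarrow> 0) sequentially"
    and trB: "((\<lambda>\<iota>. (1 / of_nat (N \<iota>)) * (\<integral>\<omega>. mat_tr (B \<iota> \<omega>) \<partial>(M \<iota>))
                  - complex_of_real \<beta>) \<longlongrightarrow> 0) sequentially"
    and free: "\<And>k::nat. k \<ge> 1 \<Longrightarrow>
       ((\<lambda>\<iota>. (1 / of_nat (N \<iota>)) * (\<integral>\<omega>. mat_tr
           (((A \<iota> \<omega> - complex_of_real \<alpha> \<cdot>\<^sub>m 1\<^sub>m (N \<iota>))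
             * (B \<iota> \<omega> - complex_of_real \<beta> \<cdot>\<^sub>m 1\<^sub>m (N \<iota>))) ^\<^sub>m k) \<partial>(M \<iota>)))
         \<longlongrightarrow> 0) sequentially"
  shows "converges_in_moments (\<lambda>\<iota> \<omega>. esd (A \<iota> \<omega> * B \<iota> \<omega> * A \<iota> \<omega>)) M (MANOVA \<alpha> \<beta>)"
proof -
  interpret manova_params \<alpha> \<beta> by unfold_locales (fact \<alpha> \<beta>)+
  let ?\<alpha> = "complex_of_real \<alpha>" and ?\<beta> = "complex_of_real \<beta>"
  define a where "a \<iota> \<omega> = A \<iota> \<omega> - ?\<alpha> \<cdot>\<^sub>m 1\<^sub>m (N \<iota>)" for \<iota> \<omega>
  define b where "b \<iota> \<omega> = B \<iota> \<omega> - ?\<beta> \<cdot>\<^sub>m 1\<^sub>m (N \<iota>)" for \<iota> \<omega>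
  define Y where "Y \<iota> \<omega> = A \<iota> \<omega> * B \<iota> \<omega> * A \<iota> \<omega>" for \<iota> \<omega>
  define W where "W \<iota> k m \<omega> = compressed_word (N \<iota>) (A \<iota> \<omega>) (B \<iota> \<omega>) ?\<alpha> ?\<beta> k m" for \<iota> k m \<omega>
  define tC where "tC \<iota> k = etr (N \<iota>) (M \<iota>) (\<lambda>\<omega>. (a \<iota> \<omega> * b \<iota> \<omega>) ^\<^sub>m k)" for \<iota> k
  define ta where "ta \<iota> k = etr (N \<iota>) (M \<iota>) (\<lambda>\<omega>. a \<iota> \<omega> * (a \<iota> \<omega> * b \<iota> \<omega>) ^\<^sub>m k)" for \<iota> k
  define tb where "tb \<iota> k = etr (N \<iota>) (M \<iota>) (\<lambda>\<omega>. b \<iota> \<omega> * (a \<iota> \<omega> * b \<iota> \<omega>) ^\<^sub>m k)" for \<iota> k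
  define r where "r \<iota> k m = etr (N \<iota>) (M \<iota>) (W \<iota> k m)" for \<iota> k m

  \<comment> \<open>Boundedness and measurability of the random matrices\<close>
  have A_rv: "bdd_mat_rv (N \<iota>) (M \<iota>) (A \<iota>)" and B_rv: "bdd_mat_rv (N \<iota>) (M \<iota>) (B \<iota>)" for \<iota>
    by (rule bdd_mat_rv_orth_proj; use A_proj B_proj A_meas B_meas in simp)+
  have a_rv: "bdd_mat_rv (N \<iota>) (M \<iota>) (a \<iota>)" and b_rv: "bdd_mat_rv (N \<iota>) (M \<iota>) (b \<iota>)"
    and Y_rv: "bdd_mat_rv (N \<iota>) (M \<iota>) (Y \<iota>)" for \<iota>
    unfolding a_def[abs_def] b_def[abs_def] Y_def[abs_def]
    by (intro bdd_mat_rv_intros A_rv B_rv; simp)+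
  have W_rv: "bdd_mat_rv (N \<iota>) (M \<iota>) (W \<iota> k m)" for \<iota> k m
    unfolding W_def[abs_def] compressed_word_def
    by (intro bdd_mat_rv_intros A_rv B_rv; simp)
  note rv = a_rv b_rv A_rv B_rv Y_rv W_rv bdd_mat_rv_intros
  have two: "two_idempotents (N \<iota>) (A \<iota> \<omega>) (B \<iota> \<omega>)" if "\<omega> \<in> space (M \<iota>)" for \<iota> \<omega>
    using A_proj[OF that] B_proj[OF that] by unfold_locales (auto simp: orth_proj_mat_def)
  note lin = etr_linear[OF prob]
  have one_rv: "bdd_mat_rv (N \<iota>) (M \<iota>) (\<lambda>\<omega>. 1\<^sub>m (N \<iota>))" for \<iota> by (intro bdd_mat_rv_const) simp

  \<comment> \<open>Asymptotics of the traces of alternating words\<close>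
  have tC: "(\<lambda>\<iota>. tC \<iota> (Suc k)) \<longlonglongrightarrow> 0" for k
    using free[of "Suc k"] by (simp add: tC_def etr_def a_def b_def del: pow_mat.simps)
  have A_lim: "(\<lambda>\<iota>. etr (N \<iota>) (M \<iota>) (A \<iota>)) \<longlonglongrightarrow> ?\<alpha>" and B_lim: "(\<lambda>\<iota>. etr (N \<iota>) (M \<iota>) (B \<iota>)) \<longlonglongrightarrow> ?\<beta>"
    using LIM_zero_cancel[OF trA] LIM_zero_cancel[OF trB] by (simp_all add: etr_def)
  have ta0: "ta \<iota> 0 = 1 * etr (N \<iota>) (M \<iota>) (A \<iota>) + - ?\<alpha> * etr (N \<iota>) (M \<iota>) (\<lambda>_. 1\<^sub>m (N \<iota>)) + 0 * etr (N \<iota>) (M \<iota>) (A \<iota>)"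
    for \<iota> unfolding ta_def
  proof (rule lin[OF A_rv one_rv A_rv])
    fix \<omega> assume \<omega>: "\<omega> \<in> space (M \<iota>)"
    show "mat_tr (a \<iota> \<omega> * (a \<iota> \<omega> * b \<iota> \<omega>) ^\<^sub>m 0) = 1 * mat_tr (A \<iota> \<omega>) + - ?\<alpha> * mat_tr (1\<^sub>m (N \<iota>)) + 0 * mat_tr (A \<iota> \<omega>)"
      using bdd_mat_rv_carrier[OF A_rv \<omega>] bdd_mat_rv_carrier[OF B_rv \<omega>] unfolding a_def b_def
      by (simp add: mat_tr_minus[of _ "N \<iota>"] mat_tr_smult[of _ "N \<iota>"] right_mult_one_mat[of _ "N \<iota>" "N \<iota>"])
  qed
  have tb0: "tb \<iota> 0 = 1 * etr (N \<iota>) (M \<iota>) (B \<iota>) + - ?\<beta> * etr (N \<iota>) (M \<iota>) (\<lambda>_. 1\<^sub>m (N \<iota>)) + 0 * etr (N \<iota>) (M \<iota>) (A \<iota>)"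
    for \<iota> unfolding tb_def
  proof (rule lin[OF B_rv one_rv A_rv])
    fix \<omega> assume \<omega>: "\<omega> \<in> space (M \<iota>)"
    show "mat_tr (b \<iota> \<omega> * (a \<iota> \<omega> * b \<iota> \<omega>) ^\<^sub>m 0) = 1 * mat_tr (B \<iota> \<omega>) + - ?\<beta> * mat_tr (1\<^sub>m (N \<iota>)) + 0 * mat_tr (A \<iota> \<omega>)"
      using bdd_mat_rv_carrier[OF A_rv \<omega>] bdd_mat_rv_carrier[OF B_rv \<omega>] unfolding a_def b_def
      by (simp add: mat_tr_minus[of _ "N \<iota>"] mat_tr_smult[of _ "N \<iota>"] right_mult_one_mat[of _ "N \<iota>" "N \<iota>"])
  qed
  have ta_Suc: "ta \<iota> (Suc k) = (1 - 2 * ?\<alpha>) * tC \<iota> (Suc k) + (?\<alpha> * (1 - ?\<alpha>)) * tb \<iota> k + 0 * tC \<iota> 0" for \<iota> k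
    unfolding ta_def tC_def tb_def
  proof (rule lin)
    fix \<omega> assume \<omega>: "\<omega> \<in> space (M \<iota>)"
    show "mat_tr (a \<iota> \<omega> * (a \<iota> \<omega> * b \<iota> \<omega>) ^\<^sub>m Suc k) = (1 - 2 * ?\<alpha>) * mat_tr ((a \<iota> \<omega> * b \<iota> \<omega>) ^\<^sub>m Suc k)
      + (?\<alpha> * (1 - ?\<alpha>)) * mat_tr (b \<iota> \<omega> * (a \<iota> \<omega> * b \<iota> \<omega>) ^\<^sub>m k) + 0 * mat_tr ((a \<iota> \<omega> * b \<iota> \<omega>) ^\<^sub>m 0)"
      using two_idempotents.mat_tr_a_pow[OF two[OF \<omega>], where \<alpha> = ?\<alpha> and \<beta> = ?\<beta> and k = k] unfolding a_def b_def by simp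
  qed (intro rv)+
  have tb_Suc: "tb \<iota> (Suc k) = (1 - 2 * ?\<beta>) * tC \<iota> (Suc k) + (?\<beta> * (1 - ?\<beta>)) * ta \<iota> k + 0 * tC \<iota> 0" for \<iota> k
    unfolding ta_def tC_def tb_def
  proof (rule lin)
    fix \<omega> assume \<omega>: "\<omega> \<in> space (M \<iota>)"
    show "mat_tr (b \<iota> \<omega> * (a \<iota> \<omega> * b \<iota> \<omega>) ^\<^sub>m Suc k) = (1 - 2 * ?\<beta>) * mat_tr ((a \<iota> \<omega> * b \<iota> \<omega>) ^\<^sub>m Suc k)
      + (?\<beta> * (1 - ?\<beta>)) * mat_tr (a \<iota> \<omega> * (a \<iota> \<omega> * b \<iota> \<omega>) ^\<^sub>m k) + 0 * mat_tr ((a \<iota> \<omega> * b \<iota> \<omega>) ^\<^sub>m 0)"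
      using two_idempotents.mat_tr_b_pow[OF two[OF \<omega>], where \<alpha> = ?\<alpha> and \<beta> = ?\<beta> and k = k] unfolding a_def b_def by simp
  qed (intro rv)+
  \<comment> \<open>The induction must treat both sequences at once, since each one at
    \<open>Suc k\<close> refers to the other at \<open>k\<close>. The start is the pair of
    hypotheses on the traces of \<open>A\<close> and \<open>B\<close>.\<close>
  have tab: "(\<lambda>\<iota>. ta \<iota> k) \<longlonglongrightarrow> 0 \<and> (\<lambda>\<iota>. tb \<iota> k) \<longlonglongrightarrow> 0" for k
  proof (induction k)
    case 0
    have one: "etr (N \<iota>) (M \<iota>) (\<lambda>_. 1\<^sub>m (N \<iota>)) = 1" for \<iota> by (intro etr_one prob N_pos)
    show ?case unfolding ta0 tb0 one using A_lim B_lim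
      by (simp add: LIM_zero)
  next
    case (Suc k)
    have "(\<lambda>\<iota>. (1 - 2 * ?\<alpha>) * tC \<iota> (Suc k) + (?\<alpha> * (1 - ?\<alpha>)) * tb \<iota> k) \<longlonglongrightarrow> (1 - 2 * ?\<alpha>) * 0 + (?\<alpha> * (1 - ?\<alpha>)) * 0"
      "(\<lambda>\<iota>. (1 - 2 * ?\<beta>) * tC \<iota> (Suc k) + (?\<beta> * (1 - ?\<beta>)) * ta \<iota> k) \<longlonglongrightarrow> (1 - 2 * ?\<beta>) * 0 + (?\<beta> * (1 - ?\<beta>)) * 0"
      using Suc by (intro tendsto_intros tC; simp)+
    then show ?case unfolding ta_Suc tb_Suc by simp
  qed
  have r_Suc_0: "r \<iota> (Suc k) 0 = 1 * ta \<iota> (Suc k) + ?\<alpha> * tC \<iota> (Suc k) + 0 * tC \<iota> 0" for \<iota> k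
    unfolding r_def ta_def tC_def
  proof (rule lin)
    fix \<omega> assume \<omega>: "\<omega> \<in> space (M \<iota>)"
    show "mat_tr (W \<iota> (Suc k) 0 \<omega>) = 1 * mat_tr (a \<iota> \<omega> * (a \<iota> \<omega> * b \<iota> \<omega>) ^\<^sub>m Suc k)
      + ?\<alpha> * mat_tr ((a \<iota> \<omega> * b \<iota> \<omega>) ^\<^sub>m Suc k) + 0 * mat_tr ((a \<iota> \<omega> * b \<iota> \<omega>) ^\<^sub>m 0)"
      using two_idempotents.mat_tr_R_k_0[OF two[OF \<omega>], where \<alpha> = ?\<alpha> and \<beta> = ?\<beta> and k = "Suc k"] unfolding a_def b_def W_def by simp
  qed (intro rv)+
  have r_0: "r \<iota> 0 0 = etr (N \<iota>) (M \<iota>) (A \<iota>)" "r \<iota> 0 (Suc m) = etr (N \<iota>) (M \<iota>) (\<lambda>\<omega>. Y \<iota> \<omega> ^\<^sub>m Suc m)" for \<iota> m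
    unfolding r_def etr_def
    by (rule arg_cong[where f = "\<lambda>x. _ * x"], rule Bochner_Integration.integral_cong[OF refl],
        simp add: W_def Y_def two_idempotents.mat_tr_R_0[OF two] del: pow_mat.simps)+

  \<comment> \<open>Limits of all compressed words\<close>
  have lim: "(\<lambda>\<iota>. r \<iota> k m) \<longlonglongrightarrow> of_real (\<Lambda> (\<lambda>x. Q k x * x ^ m))" for k m
  proof (rule tendsto_\<Lambda>)
    show "(\<lambda>\<iota>. r \<iota> 0 0) \<longlonglongrightarrow> ?\<alpha>" unfolding r_0 by (rule A_lim)
    show "(\<lambda>\<iota>. r \<iota> (Suc k) 0) \<longlonglongrightarrow> 0" for k
    proof -
      have "(\<lambda>\<iota>. ta \<iota> (Suc k) + ?\<alpha> * tC \<iota> (Suc k)) \<longlonglongrightarrow> 0 + ?\<alpha> * 0"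
        using tab[of "Suc k"] by (intro tendsto_intros tC) simp
      then show ?thesis unfolding r_Suc_0 by simp
    qed
    show "r \<iota> (Suc (Suc k)) m = r \<iota> (Suc k) (Suc m) - of_real c * r \<iota> (Suc k) m - of_real d * r \<iota> k m" for \<iota> k m
    proof -
      have "r \<iota> (Suc (Suc k)) m = 1 * r \<iota> (Suc k) (Suc m) + (- of_real c) * r \<iota> (Suc k) m + (- of_real d) * r \<iota> k m"
        unfolding r_def
      proof (rule lin)
        fix \<omega> assume \<omega>: "\<omega> \<in> space (M \<iota>)"
        have cd: "of_real c = ?\<alpha> + ?\<beta> - 2 * ?\<alpha> * ?\<beta>" "of_real d = ?\<alpha> * ?\<beta> * (1 - ?\<alpha>) * (1 - ?\<beta>)"
          by (simp_all add: c_def d_def)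
        show "mat_tr (W \<iota> (Suc (Suc k)) m \<omega>) = 1 * mat_tr (W \<iota> (Suc k) (Suc m) \<omega>)
            + (- of_real c) * mat_tr (W \<iota> (Suc k) m \<omega>) + (- of_real d) * mat_tr (W \<iota> k m \<omega>)"
          using two_idempotents.mat_tr_R_rec[OF two[OF \<omega>], where \<alpha> = ?\<alpha> and \<beta> = ?\<beta> and k = k and m = m]
          unfolding W_def cd[symmetric] by simp
      qed (intro rv)+
      then show ?thesis by simp
    qed
    show "r \<iota> (Suc 0) m = of_real (1 - \<alpha>) * r \<iota> 0 (Suc m) - of_real ((1 - \<alpha>) * \<beta>) * r \<iota> 0 m" for \<iota> m
    proof -
      have "r \<iota> (Suc 0) m = of_real (1 - \<alpha>) * r \<iota> 0 (Suc m) + (- of_real ((1 - \<alpha>) * \<beta>)) * r \<iota> 0 m + 0 * r \<iota> 0 m"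
        unfolding r_def
      proof (rule lin)
        fix \<omega> assume \<omega>: "\<omega> \<in> space (M \<iota>)"
        show "mat_tr (W \<iota> (Suc 0) m \<omega>) = of_real (1 - \<alpha>) * mat_tr (W \<iota> 0 (Suc m) \<omega>)
            + (- of_real ((1 - \<alpha>) * \<beta>)) * mat_tr (W \<iota> 0 m \<omega>) + 0 * mat_tr (W \<iota> 0 m \<omega>)"
          using two_idempotents.mat_tr_R_1[OF two[OF \<omega>], where \<alpha> = ?\<alpha> and \<beta> = ?\<beta> and m = m]
          unfolding W_def by simp
      qed (intro rv)+
      then show ?thesis by simp
    qed
  qed
  show ?thesis unfolding converges_in_moments_def
  proof (intro allI impI)
    fix k :: nat assume "k \<ge> 1"
    \<comment> \<open>Positivity of the exponent is used twice: \<open>0 ^ k = 0\<close> removes the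
      term \<open>(1 - \<alpha>) * p 0\<close> of the MANOVA integral, and
      \<open>r \<iota> 0 (Suc m)\<close> is a normalised moment of \<open>Y\<close>, whereas
      \<open>r \<iota> 0 0\<close> is the trace of \<open>A\<close>.\<close>
    then obtain m where k: "k = Suc m" by (cases k) auto
    have "continuous_on UNIV (\<lambda>x::real. x ^ k)" by (intro continuous_intros)
    from has_bochner_integral_MANOVA[OF this]
    have int: "integrable (MANOVA \<alpha> \<beta>) (\<lambda>x. x ^ k)" "(\<integral>x. x ^ k \<partial>MANOVA \<alpha> \<beta>) = \<Lambda> (\<lambda>x. x ^ k)"
      unfolding has_bochner_integral_iff k by simp_all
    have "(\<integral>\<omega>. (\<integral>x. x ^ k \<partial>esd (A \<iota> \<omega> * B \<iota> \<omega> * A \<iota> \<omega>)) \<partial>M \<iota>) = Re (r \<iota> 0 k)" for \<iota>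
    proof -
      have "(\<integral>\<omega>. (\<integral>x. x ^ k \<partial>esd (A \<iota> \<omega> * B \<iota> \<omega> * A \<iota> \<omega>)) \<partial>M \<iota>)
          = (\<integral>\<omega>. Re (mat_tr (Y \<iota> \<omega> ^\<^sub>m k)) / real (N \<iota>) \<partial>M \<iota>)"
      proof (rule Bochner_Integration.integral_cong[OF refl])
        fix \<omega> assume \<omega>: "\<omega> \<in> space (M \<iota>)"
        show "(\<integral>x. x ^ k \<partial>esd (A \<iota> \<omega> * B \<iota> \<omega> * A \<iota> \<omega>)) = Re (mat_tr (Y \<iota> \<omega> ^\<^sub>m k)) / real (N \<iota>)"
          unfolding Y_def[symmetric] using bdd_mat_rv_carrier[OF Y_rv \<omega>] N_pos
          by (rule integral_esd_power) (simp add: Y_def hermitian_ABA[OF A_proj[OF \<omega>] B_proj[OF \<omega>]])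
      qed
      also have "\<dots> = Re (\<integral>\<omega>. mat_tr (Y \<iota> \<omega> ^\<^sub>m k) \<partial>M \<iota>) / real (N \<iota>)"
        using integrable_mat_tr[OF prob bdd_mat_rv_pow[OF Y_rv]] by simp
      also have "\<dots> = Re (r \<iota> 0 k)" unfolding k r_0 etr_def by (simp add: Re_divide_of_nat del: pow_mat.simps)
      finally show ?thesis .
    qed
    moreover have "(\<lambda>\<iota>. Re (r \<iota> 0 k)) \<longlonglongrightarrow> \<Lambda> (\<lambda>x. x ^ k)"
      using tendsto_Re[OF lim[of 0 k]] by simp
    ultimately show "integrable (MANOVA \<alpha> \<beta>) (\<lambda>x. x ^ k) \<and>
        (\<lambda>\<iota>. \<integral>\<omega>. (\<integral>x. x ^ k \<partial>esd (A \<iota> \<omega> * B \<iota> \<omega> * A \<iota> \<omega>)) \<partial>M \<iota>) \<longlonglongrightarrow> (\<integral>x. x ^ k \<partial>MANOVA \<alpha> \<beta>)"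
      using int by simp
  qed
qed

end
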